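(* For every integer $n\ge 3$, $$M(n,2,3,1,1) = n,\qquad M(n,2,3,1,2) = \binom{n}{2} - \binom{\lfloor n/2\rfloor}{2},$$ $$M(n,2,3,2,1) = n,\qquad M(n,2,3,2,2) = \binom{n}{2} - \binom{\lfloor n/2\rfloor}{2}.$$ Moreover, $$\lim_{n\to \infty} \binom{n}{3}^{-1} M(n,2,3,1,3) = 6\sqrt{21}-27\approx 0.495$$ and $$0.24 \le \lim_{n\to \infty} \binom{n}{3}^{-1} M(n,2,3,2,3)\le \frac{3}{8}.$$
   Context: $K_n^k$ denotes the complete $k$-uniform hypergraph on a vertex set $V_n$ of size $n$, where $n\ge k\ge 2$ (its edges are all $k$-subsets of $V_n$). Hypergraphs are identified with their edge sets. For a hypergraph or edge set $H$ and a positive integer $s$, the $s$-shadow is $E^{(s)}(H)=\{S : |S|=s,\ \exists e\in H: S\subseteq e\}$. For a hypergraph $H$, the $t$-tight components of $H$ are the classes of the partition of the edges of $H$ obtained by starting from singletons (one per edge) and iteratively merging two classes whenever one contains an edge $e$ and the other an edge $f$ with $|e\cap f|\ge t$, until no further merging is possible; $TC_t(H)$ is the family of these edge sets. $\mathrm{Col}_r(H)$ is the family of all (not necessarily proper) colorings of the edges of $H$ with colors $1,\dots,r$ (not all colors need be used). For $\mathbf{c}\in \mathrm{Col}_r(K_n^k)$ let $H_i=H_i(\mathbf{c})$ be the $k$-uniform hypergraph of all edges of color $i$, and define, for positive integers $t\le k-1$ and $s\le k$, $$M(n,r,k,t,s;\mathbf{c})=\max_{i\in\{1,\dots,r\}}\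 \max_{C\in TC_t(H_i)}|E^{(s)}(C)|$$ (color classes with no edges are ignored), and $M(n,r,k,t,s)=\min_{\mathbf{c}\in \mathrm{Col}_r(K_n^k)} M(n,r,k,t,s;\mathbf{c})$. The assertions about limits include that the limits exist. *)

theory Defs
  imports Complex_Main "HOL-Library.Ramsey" "HOL-Library.Disjoint_Sets"
begin

text \<open>Hypergraphs are identified with their edge sets.  The vertex set \<open>V\<^sub>n\<close> is \<open>{..<n}\<close>.\<close>

definition complete_hypergraph :: "nat \<Rightarrow> nat \<Rightarrow> nat set set" where
  "complete_hypergraph n k = nsets {..<n} k"

definition shadow :: "nat \<Rightarrow> 'a set set \<Rightarrow> 'a set set" where
  "shadow s H = {S. card S = s \<and> (\<exists>e\<in>H. S \<subseteq> e)}"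

definition merge_step :: "nat \<Rightarrow> 'a set set set \<Rightarrow> 'a set set set \<Rightarrow> bool" where
  "merge_step t P Q \<longleftrightarrow>
     (\<exists>A\<in>P. \<exists>B\<in>P. A \<noteq> B \<and> (\<exists>e\<in>A. \<exists>f\<in>B. t \<le> card (e \<inter> f)) \<and>
        Q = insert (A \<union> B) (P - {A, B}))"

text \<open>The outcome of merging until no further merging is possible.  For finite \<open>H\<close> the outcome
  exists and does not depend on the order of the merging steps: see \<open>merging_outcome_iff\<close> below.\<close>

definition tight_components :: "nat \<Rightarrow> 'a set set \<Rightarrow> 'a set set set" where
  "tight_components t H =
     (THE P. (merge_step t)\<^sup>*\<^sup>* ((\<lambda>e. {e}) ` H) P \<and> (\<nexists>Q. merge_step t P Q))"

definition colorings :: "nat \<Rightarrow> 'a set set \<Rightarrow> ('a set \<Rightarrow> nat) set" where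
  "colorings r H = H \<rightarrow>\<^sub>E {1..r}"

definition color_class :: "nat \<Rightarrow> nat \<Rightarrow> (nat set \<Rightarrow> nat) \<Rightarrow> nat \<Rightarrow> nat set set" where
  "color_class n k c i = {e \<in> complete_hypergraph n k. c e = i}"

text \<open>The quantities \<open>M(n,r,k,t,s;c)\<close> and \<open>M(n,r,k,t,s)\<close>.  They are meaningful for \<open>k \<le> n\<close> and
  \<open>1 \<le> r\<close>, when all maxima and minima below are over finite nonempty sets.\<close>

definition M_coloring ::
    "nat \<Rightarrow> nat \<Rightarrow> nat \<Rightarrow> nat \<Rightarrow> nat \<Rightarrow> (nat set \<Rightarrow> nat) \<Rightarrow> nat" where
  "M_coloring n r k t s c =
     (MAX i \<in> {i \<in> {1..r}. color_class n k c i \<noteq> {}}.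
        MAX C \<in> tight_components t (color_class n k c i). card (shadow s C))"

definition M :: "nat \<Rightarrow> nat \<Rightarrow> nat \<Rightarrow> nat \<Rightarrow> nat \<Rightarrow> nat" where
  "M n r k t s = (MIN c \<in> colorings r (complete_hypergraph n k). M_coloring n r k t s c)"


definition tight_adj :: "nat \<Rightarrow> 'a set set \<Rightarrow> ('a set \<times> 'a set) set" where
  "tight_adj t H = {(e, f). e \<in> H \<and> f \<in> H \<and> t \<le> card (e \<inter> f)}"

lemma sym_tight_adj: "sym (tight_adj t H)"
  by (auto simp: tight_adj_def sym_def Int_commute)

lemma merge_step_invariant:
  assumes "(merge_step t)\<^sup>*\<^sup>* ((\<lambda>e. {e}) ` H) P"
  shows "partition_on H P \<and> (\<forall>A\<in>P. \<forall>e\<in>A. \<forall>f\<in>A. (e, f) \<in> (tight_adj t H)\<^sup>*)"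
  using assms
proof (induction rule: rtranclp_induct)
  case base
  then show ?case by (auto simp: partition_on_def disjoint_def)
next
  case (step P Q)
  have part: "partition_on H P"
    and conn: "\<And>A e f. A \<in> P \<Longrightarrow> e \<in> A \<Longrightarrow> f \<in> A \<Longrightarrow> (e, f) \<in> (tight_adj t H)\<^sup>*"
    using step.IH by auto
  obtain A B e0 f0 where AB: "A \<in> P" "B \<in> P" "A \<noteq> B" "e0 \<in> A" "f0 \<in> B" "t \<le> card (e0 \<inter> f0)"
    and Q: "Q = insert (A \<union> B) (P - {A, B})"
    using step.hyps(2) unfolding merge_step_def by blast
  have un: "\<Union>P = H" and ne: "{} \<notin> P"
    and disj: "\<And>X Y. X \<in> P \<Longrightarrow> Y \<in> P \<Longrightarrow> X \<noteq> Y \<Longrightarrow> X \<inter> Y = {}"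
    using part by (auto simp: partition_on_def disjoint_def)
  have "\<Union>Q = H" using un AB Q by auto
  moreover have "{} \<notin> Q" using ne AB Q by auto
  moreover have "disjoint Q"
  proof (rule disjointI)
    fix X Y assume "X \<in> Q" "Y \<in> Q" "X \<noteq> Y"
    then consider "X = A \<union> B" "Y \<in> P" "Y \<noteq> A" "Y \<noteq> B"
      | "Y = A \<union> B" "X \<in> P" "X \<noteq> A" "X \<noteq> B" | "X \<in> P" "Y \<in> P"
      unfolding Q by auto
    then show "X \<inter> Y = {}"
    proof cases
      case 1
      then show ?thesis using disj[of Y A] disj[of Y B] AB(1,2) by auto
    next
      case 2
      then show ?thesis using disj[of X A] disj[of X B] AB(1,2) by auto
    next
      case 3
      then show ?thesis using disj \<open>X \<noteq> Y\<close> by simp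
    qed
  qed
  ultimately have "partition_on H Q" by (simp add: partition_on_def)
  moreover have "(e, f) \<in> (tight_adj t H)\<^sup>*" if "X \<in> Q" "e \<in> X" "f \<in> X" for X e f
  proof -
    have adj: "(e0, f0) \<in> (tight_adj t H)\<^sup>*"
    proof (rule r_into_rtrancl)
      show "(e0, f0) \<in> tight_adj t H" using AB un by (auto simp: tight_adj_def)
    qed
    then have adj': "(f0, e0) \<in> (tight_adj t H)\<^sup>*"
      by (meson sym_tight_adj sym_rtrancl symD)
    show ?thesis
    proof (cases "X = A \<union> B")
      case True
      then consider "e \<in> A" "f \<in> A" | "e \<in> A" "f \<in> B" | "e \<in> B" "f \<in> A" | "e \<in> B" "f \<in> B"
        using \<open>e \<in> X\<close> \<open>f \<in> X\<close> by blast
      then show ?thesis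
      proof cases
        case 1
        then show ?thesis using conn AB(1) by blast
      next
        case 2
        have "(e, e0) \<in> (tight_adj t H)\<^sup>*" "(f0, f) \<in> (tight_adj t H)\<^sup>*"
          using conn 2 AB by blast+
        then show ?thesis using adj by (meson rtrancl_trans)
      next
        case 3
        have "(e, f0) \<in> (tight_adj t H)\<^sup>*" "(e0, f) \<in> (tight_adj t H)\<^sup>*"
          using conn 3 AB by blast+
        then show ?thesis using adj' by (meson rtrancl_trans)
      next
        case 4
        then show ?thesis using conn AB(2) by blast
      qed
    next
      case False
      then have "X \<in> P" using \<open>X \<in> Q\<close> Q by simp
      then show ?thesis using conn \<open>e \<in> X\<close> \<open>f \<in> X\<close> by blast
    qed
  qed
  ultimately show ?case by blast
qed

lemma merging_outcome:
  assumes "(merge_step t)\<^sup>*\<^sup>* ((\<lambda>e. {e}) ` H) P" and "\<nexists>Q. merge_step t P Q"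
  shows "P = H // (tight_adj t H)\<^sup>*"
proof -
  have part: "partition_on H P"
    and conn: "\<And>A e f. A \<in> P \<Longrightarrow> e \<in> A \<Longrightarrow> f \<in> A \<Longrightarrow> (e, f) \<in> (tight_adj t H)\<^sup>*"
    using merge_step_invariant[OF assms(1)] by auto
  have un: "\<Union>P = H" and ne: "{} \<notin> P"
    using part by (auto simp: partition_on_def)
  have cls: "(tight_adj t H)\<^sup>* `` {e} = A" if A: "A \<in> P" "e \<in> A" for A e
  proof
    show "A \<subseteq> (tight_adj t H)\<^sup>* `` {e}" using conn A by auto
    have "f \<in> A" if "(e, f) \<in> (tight_adj t H)\<^sup>*" for f
      using that
    proof (induction rule: rtrancl_induct)
      case base
      show ?case by (fact A(2))
    next
      case (step g f)
      then have "f \<in> H" "t \<le> card (g \<inter> f)" by (auto simp: tight_adj_def)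
      then obtain B where B: "B \<in> P" "f \<in> B" using un by auto
      have "A = B"
        using assms(2) B A(1) step.IH \<open>t \<le> card (g \<inter> f)\<close> unfolding merge_step_def by blast
      then show ?case using B by simp
    qed
    then show "(tight_adj t H)\<^sup>* `` {e} \<subseteq> A" by auto
  qed
  show ?thesis
  proof
    show "P \<subseteq> H // (tight_adj t H)\<^sup>*"
    proof
      fix A assume A: "A \<in> P"
      then obtain e where "e \<in> A" using ne by (metis ex_in_conv)
      then show "A \<in> H // (tight_adj t H)\<^sup>*"
        using A cls[OF A \<open>e \<in> A\<close>] un by (auto simp: quotient_def)
    qed
    show "H // (tight_adj t H)\<^sup>* \<subseteq> P"
    proof
      fix A assume "A \<in> H // (tight_adj t H)\<^sup>*"
      then obtain e where "e \<in> H" "A = (tight_adj t H)\<^sup>* `` {e}" by (rule quotientE)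
      moreover from \<open>e \<in> H\<close> obtain B where "B \<in> P" "e \<in> B" using un by blast
      ultimately show "A \<in> P" using cls[of B e] by simp
    qed
  qed
qed

lemma merging_outcome_exists:
  assumes "finite P"
  shows "\<exists>Q. (merge_step t)\<^sup>*\<^sup>* P Q \<and> (\<nexists>R. merge_step t Q R)"
  using assms
proof (induction "card P" arbitrary: P rule: less_induct)
  case less
  show ?case
  proof (cases "\<exists>Q. merge_step t P Q")
    case True
    then obtain Q A B where Q: "merge_step t P Q" "A \<in> P" "B \<in> P" "A \<noteq> B"
      "Q = insert (A \<union> B) (P - {A, B})"
      unfolding merge_step_def by blast
    have "card (P - {A, B}) = card P - 2" using Q less.prems by (simp add: card_Diff_subset)
    moreover have "card P \<ge> 2" using Q less.prems card_mono[of P "{A, B}"] by simp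
    moreover have "card Q \<le> Suc (card (P - {A, B}))"
      using Q(5) less.prems by (simp add: card_insert_if)
    ultimately have "card Q < card P" by linarith
    moreover have "finite Q" using Q less.prems by simp
    ultimately show ?thesis using less.hyps Q(1) by (meson converse_rtranclp_into_rtranclp)
  qed auto
qed

lemma merging_outcome_iff:
  assumes "finite H"
  shows "(merge_step t)\<^sup>*\<^sup>* ((\<lambda>e. {e}) ` H) P \<and> (\<nexists>Q. merge_step t P Q) \<longleftrightarrow>
           P = H // (tight_adj t H)\<^sup>*"
  using merging_outcome merging_outcome_exists[of "(\<lambda>e. {e}) ` H" t] assms by blast

lemma tight_components_eq_quotient:
  assumes "finite H"
  shows "tight_components t H = H // (tight_adj t H)\<^sup>*"
  unfolding tight_components_def merging_outcome_iff[OF assms] by simp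

end

theory Submission
  imports Defs
begin

text \<open>
  Fix a two-colouring of the triples and a vertex \<open>v\<close>.  The link of \<open>v\<close> is a two-coloured complete
  graph, and one of the two colours of such a graph is connected.  Triples through \<open>v\<close> whose link
  edges share a vertex meet in two vertices, so for that colour \<open>i\<close> all triples of colour \<open>i\<close> through
  \<open>v\<close> lie in one 2-tight component, and this component covers every pair at \<open>v\<close>: colour \<open>i\<close>
  \<open>dominates\<close> \<open>v\<close>.  If one colour dominates both \<open>u\<close> and \<open>v\<close>, the two components share the pair
  \<open>uv\<close> and hence coincide.  Everything rests on this observation.

  \<^bold>\<open>Vertices and pairs.\<close>  The component at a dominated vertex covers all vertices.  One of the
  colours dominates at least half of the vertices, and a single 2-tight component covers all pairs
  that meet this half, which gives the lower bound for pairs.  Colouring a triple by the half of the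
  vertex set that contains its majority shows that this is optimal, even for 1-tight components.

  \<^bold>\<open>Triples, 1-tight components.\<close>  A colour that dominates some vertex has a single component.
  The components of the other colour have disjoint vertex sets; let \<open>q n\<close> be the size of the largest
  one.  If both colours have only components of at most \<open>\<theta>\<close> times all triples, then for \<open>q \<ge> 1/2\<close>
  the first colour contains the triples that cross between the largest vertex set and the rest, so
  that \<open>3 q (1 - q) \<le> \<theta>\<close>, while the first colour and the component on the largest vertex set
  together miss only triples outside this set, so that \<open>1 - (1 - q)\<^sup>3 \<le> 2 \<theta>\<close>.  (For \<open>q < 1/2\<close> the
  first colour has three quarters of all triples.)  The first bound decreases in \<open>q\<close>, the second
  one increases, and they cross at \<open>q = (\<surd>21 - 3) / 2\<close> with \<open>\<theta> = 6 \<surd>21 - 27\<close>.  Splitting the vertices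
  in this ratio, and giving one colour to the triples inside a part and the other to the crossing
  triples, attains the value.

  \<^bold>\<open>Triples, 2-tight components.\<close>  The limit exists because an optimal colouring of the triples of
  \<open>n\<close> vertices can be blown up: a triple with two vertices in the class of \<open>v\<close> gets the colour that
  dominates \<open>v\<close>, and this does not merge components.  For the upper bound \<open>3/8\<close>, split the vertices
  into halves and colour a triple by the parity of its intersection with one half: the triples with
  a given intersection size are unions of components.  For the lower bound, split
  the vertices into two parts such that each colour dominates one of them.  If both parts contain
  more than a quarter of the vertices, the two components at them together contain all the crossing
  triples.  Otherwise one colour dominates at least three quarters of the vertices and its component
  contains nearly all of that colour; if this component is small, the
  other colour is dense.  Since 2-tight components have disjoint 2-shadows and a hypergraph with
  \<open>g\<close> shadow pairs has at most \<open>(\<surd>2 / 3) g powr (3/2)\<close> triples, the other colour must then have a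
  large component.
\<close>

section \<open>Binomial coefficients and finite sets of fixed size\<close>

lemma real_choose_two: "real (n choose 2) = real n * (real n - 1) / 2"
  by (induction n) (auto simp: numeral_2_eq_2 field_simps)

lemma real_choose_three: "real (n choose 3) = real n * (real n - 1) * (real n - 2) / 6"
proof (induction n)
  case (Suc n)
  have "Suc n choose 3 = (n choose 2) + (n choose 3)"
    by (simp add: numeral_3_eq_3 numeral_2_eq_2)
  then show ?case
    using Suc by (simp add: real_choose_two field_simps)
qed (simp add: binomial_eq_0)

text \<open>The comparison loses nothing to lower order, so that the lower bound for connected components
  below needs no error term.\<close>

lemma choose_three_le:
  assumes "m \<le> n"
  shows "real (m choose 3) \<le> (real m / real n) ^ 3 * real (n choose 3)"
proof (cases "m < 3")
  case True
  then show ?thesis by (simp add: binomial_eq_0)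
next
  case False
  define x y where "x = real m" and "y = real n"
  have xy: "3 \<le> x" "x \<le> y" using False assms by (auto simp: x_def y_def)
  have "x - 1 \<le> x * (y - 1) / y" "x - 2 \<le> x * (y - 2) / y"
    using xy by (auto simp: field_simps)
  then have "(x - 1) * (x - 2) \<le> (x * (y - 1) / y) * (x * (y - 2) / y)"
    using xy by (intro mult_mono) auto
  then have "x * ((x - 1) * (x - 2)) \<le> x * ((x * (y - 1) / y) * (x * (y - 2) / y))"
    using xy by (intro mult_left_mono) auto
  also have "\<dots> = (x / y) ^ 3 * (y * (y - 1) * (y - 2))"
    using xy by (simp add: field_simps power3_eq_cube)
  finally show ?thesis
    unfolding real_choose_three x_def[symmetric] y_def[symmetric]
    by (simp only: times_divide_eq_right divide_right_mono mult.assoc)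
qed

text \<open>The right-hand side counts the triples that meet both parts of a partition into \<open>a\<close> and \<open>b\<close>
  vertices.\<close>

lemma choose_three_split:
  assumes "n = a + b"
  shows "real (n choose 3) - real (a choose 3) - real (b choose 3) = real a * real b * (real n - 2) / 2"
  unfolding real_choose_three assms by (simp add: field_simps)

lemma card_complete: "card (complete_hypergraph n k) = n choose k"
  by (simp add: complete_hypergraph_def card_nsets)

lemma finite_complete [simp]: "finite (complete_hypergraph n k)"
  by (simp add: complete_hypergraph_def finite_imp_finite_nsets)

lemma finite_color_class [simp]: "finite (color_class n k c i)"
  by (simp add: color_class_def)

lemma complete_memD:
  assumes "e \<in> complete_hypergraph n k"
  shows "finite e" "card e = k" "e \<subseteq> {..<n}"
  using assms by (auto simp: complete_hypergraph_def nsets_def)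

lemma triple_in_complete:
  assumes "x < n" "y < n" "z < n" "x \<noteq> y" "x \<noteq> z" "y \<noteq> z"
  shows "{x, y, z} \<in> complete_hypergraph n 3"
  using assms by (auto simp: complete_hypergraph_def nsets_def)

lemma shadow_subset_nsets:
  assumes "C \<subseteq> complete_hypergraph n k"
  shows "shadow s C \<subseteq> nsets {..<n} s"
proof
  fix S assume "S \<in> shadow s C"
  then obtain e where "card S = s" "e \<in> C" "S \<subseteq> e"
    by (auto simp: shadow_def)
  then show "S \<in> nsets {..<n} s"
    using assms complete_memD[of e n k] finite_subset[of S e] by (auto simp: nsets_def)
qed

lemma finite_shadow: "C \<subseteq> complete_hypergraph n k \<Longrightarrow> finite (shadow s C)"
  by (rule finite_subset[OF shadow_subset_nsets]) (auto intro: finite_imp_finite_nsets)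

lemma card_shadow_le: "C \<subseteq> complete_hypergraph n k \<Longrightarrow> card (shadow s C) \<le> n choose s"
  using card_mono[OF _ shadow_subset_nsets, of n s C k]
  by (simp add: finite_imp_finite_nsets)

lemma shadow_mono: "C \<subseteq> D \<Longrightarrow> shadow s C \<subseteq> shadow s D"
  by (auto simp: shadow_def)

lemma shadow_self:
  assumes "C \<subseteq> complete_hypergraph n k"
  shows "shadow k C = C"
proof
  show "C \<subseteq> shadow k C" using assms complete_memD(2) by (force simp: shadow_def)
  show "shadow k C \<subseteq> C"
  proof
    fix S assume "S \<in> shadow k C"
    then obtain e where e: "card S = k" "e \<in> C" "S \<subseteq> e" by (auto simp: shadow_def)
    then have "finite e" "card e = k" using assms complete_memD by blast+
    then show "S \<in> C" using e card_subset_eq[of e S] by simp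
  qed
qed

section \<open>Tight components\<close>

lemma tight_components_subset:
  assumes "finite H" "C \<in> tight_components t H"
  shows "C \<subseteq> H" "C \<noteq> {}"
proof -
  obtain e where e: "e \<in> H" "C = (tight_adj t H)\<^sup>* `` {e}"
    using assms(2) unfolding tight_components_eq_quotient[OF assms(1)] by (rule quotientE)
  have "f \<in> H" if "(e, f) \<in> (tight_adj t H)\<^sup>*" for f
    using that e(1) by (induction) (auto simp: tight_adj_def)
  then show "C \<subseteq> H" using e by auto
  show "C \<noteq> {}" using e by auto
qed

lemma tight_component_of:
  assumes "finite H" "e \<in> H"
  shows "(tight_adj t H)\<^sup>* `` {e} \<in> tight_components t H"
  unfolding tight_components_eq_quotient[OF assms(1)] by (rule quotientI) (rule assms(2))

lemma equiv_tight: "equiv UNIV ((tight_adj t H)\<^sup>*)"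
  by (simp add: equiv_def refl_rtrancl sym_rtrancl sym_tight_adj trans_rtrancl)

lemma tight_component_eq_class:
  assumes "finite H" "C \<in> tight_components t H" "e \<in> C"
  shows "C = (tight_adj t H)\<^sup>* `` {e}"
proof -
  obtain g where g: "C = (tight_adj t H)\<^sup>* `` {g}"
    using assms(2) unfolding tight_components_eq_quotient[OF assms(1)] by (rule quotientE)
  then have "(g, e) \<in> (tight_adj t H)\<^sup>*" using assms(3) by auto
  then show ?thesis unfolding g by (rule equiv_class_eq[OF equiv_tight])
qed

lemma tight_components_eqI:
  assumes "finite H" "C \<in> tight_components t H" "D \<in> tight_components t H"
    and "e \<in> C" "f \<in> D" "t \<le> card (e \<inter> f)"
  shows "C = D"
proof -
  have "e \<in> H" "f \<in> H" using assms tight_components_subset by blast+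
  then have "(e, f) \<in> tight_adj t H"
    using assms(6) by (auto simp: tight_adj_def)
  then have "(tight_adj t H)\<^sup>* `` {e} = (tight_adj t H)\<^sup>* `` {f}"
    by (intro equiv_class_eq[OF equiv_tight] r_into_rtrancl)
  then show ?thesis
    using tight_component_eq_class[OF assms(1,2,4)] tight_component_eq_class[OF assms(1,3,5)] by simp
qed

lemma Union_tight_components: "finite H \<Longrightarrow> \<Union>(tight_components t H) = H"
proof (intro equalityI Union_least subsetI)
  fix e assume "finite H" "e \<in> H"
  then show "e \<in> \<Union>(tight_components t H)" using tight_component_of[of H e t] by blast
qed (use tight_components_subset(1) in blast)

lemma finite_tight_components: "finite H \<Longrightarrow> finite (tight_components t H)"
  by (rule finite_subset[of _ "Pow H"]) (auto dest: tight_components_subset(1))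

lemma disjoint_tight_components:
  assumes "finite H"
  shows "pairwise disjnt (tight_components t H)"
  unfolding pairwise_def disjnt_def by (metis disjoint_iff tight_component_eq_class[OF assms])

lemma card_eq_sum_tight_components:
  assumes "finite H"
  shows "card H = (\<Sum>C\<in>tight_components t H. card C)"
proof -
  have "card (\<Union>(tight_components t H)) = (\<Sum>C\<in>tight_components t H. card C)"
    using tight_components_subset(1)[OF assms] finite_subset[OF _ assms]
    by (intro card_Union_disjoint disjoint_tight_components[OF assms]) blast
  then show ?thesis by (simp add: Union_tight_components[OF assms])
qed

text \<open>Upper bounds on components come from labellings: a label that adjacent edges share is constant
  along chains of adjacent edges, so the edges with one label bound the component.\<close>

lemma tight_component_label:
  assumes "finite H" "C \<in> tight_components t H"
    and lab: "\<And>e f. e \<in> H \<Longrightarrow> f \<in> H \<Longrightarrow> t \<le> card (e \<inter> f) \<Longrightarrow> lab e = lab f"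
  obtains e where "e \<in> H" "C \<subseteq> {f \<in> H. lab f = lab e}"
proof -
  obtain e where e: "e \<in> C" using tight_components_subset(2)[OF assms(1,2)] by blast
  have "lab f = lab e" if "(e, f) \<in> (tight_adj t H)\<^sup>*" for f
    using that by induction (use lab in \<open>auto simp: tight_adj_def\<close>)
  then show ?thesis
    using that[of e] e tight_component_eq_class[OF assms(1,2) e] tight_components_subset(1)[OF assms(1,2)]
    by blast
qed

lemma tight_component_antimono:
  assumes "finite H" "C \<in> tight_components t H" "t' \<le> t"
  obtains D where "D \<in> tight_components t' H" "C \<subseteq> D"
proof -
  obtain e where e: "e \<in> C" using tight_components_subset(2)[OF assms(1,2)] by blast
  have "tight_adj t H \<subseteq> tight_adj t' H" using assms(3) by (auto simp: tight_adj_def)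
  then have "C \<subseteq> (tight_adj t' H)\<^sup>* `` {e}"
    using tight_component_eq_class[OF assms(1,2) e] rtrancl_mono by blast
  then show ?thesis
    using that tight_component_of[OF assms(1)] e tight_components_subset(1)[OF assms(1,2)] by blast
qed

section \<open>The minimax quantity\<close>

lemma M_coloring_le_iff:
  assumes "k \<le> n" "c \<in> colorings r (complete_hypergraph n k)"
  shows "M_coloring n r k t s c \<le> K \<longleftrightarrow>
    (\<forall>i\<in>{1..r}. \<forall>C\<in>tight_components t (color_class n k c i). card (shadow s C) \<le> K)"
proof -
  let ?I = "{i \<in> {1..r}. color_class n k c i \<noteq> {}}"
  let ?T = "\<lambda>i. tight_components t (color_class n k c i)"
  have ne: "?T i \<noteq> {}" if "i \<in> ?I" for i
    using Union_tight_components[of "color_class n k c i" t] that by fastforce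
  have empty: "?T i = {}" if "color_class n k c i = {}" for i
    using tight_components_subset[of "color_class n k c i" _ t] that by fastforce
  have fin: "finite (?T i)" for i by (simp add: finite_tight_components)
  have "nsets {..<n} k \<noteq> {}"
    using assms(1) card_nsets[of "{..<n}" k] by (metis card.empty binomial_eq_0_iff card_lessThan not_le)
  then obtain e where e: "e \<in> complete_hypergraph n k"
    by (auto simp: complete_hypergraph_def)
  then have "c e \<in> ?I" using assms(2) by (auto simp: colorings_def color_class_def PiE_def Pi_def)
  then have "?I \<noteq> {}" by blast
  then have "M_coloring n r k t s c \<le> K \<longleftrightarrow>
      (\<forall>i\<in>?I. (MAX C \<in> ?T i. card (shadow s C)) \<le> K)"
    unfolding M_coloring_def by (subst Max_le_iff) auto
  also have "\<dots> \<longleftrightarrow> (\<forall>i\<in>?I. \<forall>C\<in>?T i. card (shadow s C) \<le> K)"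
    using ne fin by (intro ball_cong refl) (subst Max_le_iff, auto)
  also have "\<dots> \<longleftrightarrow> (\<forall>i\<in>{1..r}. \<forall>C\<in>?T i. card (shadow s C) \<le> K)"
    using empty by auto
  finally show ?thesis .
qed

lemma finite_colorings [simp]: "finite (colorings r (complete_hypergraph n k))"
  unfolding colorings_def by (rule finite_PiE) auto

lemma colorings_nonempty: "1 \<le> r \<Longrightarrow> colorings r H \<noteq> {}"
  unfolding colorings_def by (auto simp: PiE_eq_empty_iff)

text \<open>This characterisation of upper bounds replaces the nested extrema in all that follows.  The
  empty colour classes, which the definition leaves out, have no components and hence impose no
  condition.\<close>

lemma M_le_iff:
  assumes "k \<le> n" "1 \<le> r"
  shows "M n r k t s \<le> K \<longleftrightarrow> (\<exists>c\<in>colorings r (complete_hypergraph n k).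
    \<forall>i\<in>{1..r}. \<forall>C\<in>tight_components t (color_class n k c i). card (shadow s C) \<le> K)"
proof -
  have "M n r k t s \<le> K \<longleftrightarrow>
      (\<exists>c\<in>colorings r (complete_hypergraph n k). M_coloring n r k t s c \<le> K)"
    unfolding M_def using colorings_nonempty[OF assms(2)] by (subst Min_le_iff) auto
  then show ?thesis using M_coloring_le_iff[OF assms(1)] by auto
qed

lemma M_leI:
  assumes "k \<le> n" "1 \<le> r" "\<And>e. g e \<in> {1..r}"
    and "\<And>i C. i \<in> {1..r} \<Longrightarrow> C \<in> tight_components t {e \<in> complete_hypergraph n k. g e = i} \<Longrightarrow>
      card (shadow s C) \<le> K"
  shows "M n r k t s \<le> K"
proof -
  let ?c = "restrict g (complete_hypergraph n k)"
  have "?c \<in> colorings r (complete_hypergraph n k)"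
    using assms(3) by (auto simp: colorings_def)
  moreover have "color_class n k ?c i = {e \<in> complete_hypergraph n k. g e = i}" for i
    by (auto simp: color_class_def)
  ultimately show ?thesis
    unfolding M_le_iff[OF assms(1,2)] using assms(4) by (intro bexI[of _ ?c]) auto
qed

lemma M_geI:
  assumes "k \<le> n" "1 \<le> r"
    and "\<And>c. c \<in> colorings r (complete_hypergraph n k) \<Longrightarrow>
      \<exists>i\<in>{1..r}. \<exists>C\<in>tight_components t (color_class n k c i). K \<le> card (shadow s C)"
  shows "K \<le> M n r k t s"
proof -
  obtain c where c: "c \<in> colorings r (complete_hypergraph n k)"
    "\<forall>i\<in>{1..r}. \<forall>C\<in>tight_components t (color_class n k c i). card (shadow s C) \<le> M n r k t s"
    using M_le_iff[OF assms(1,2), of t s "M n r k t s"] by auto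
  then show ?thesis using assms(3)[OF c(1)] by force
qed

text \<open>Higher tightness refines the components, so lower bounds need only be proved for 2-tight and
  upper bounds only for 1-tight components when the two agree.\<close>

lemma M_antimono_tightness:
  assumes "k \<le> n" "1 \<le> r" "t' \<le> t"
  shows "M n r k t s \<le> M n r k t' s"
proof -
  obtain c where c: "c \<in> colorings r (complete_hypergraph n k)"
    and le: "\<And>i C. i \<in> {1..r} \<Longrightarrow> C \<in> tight_components t' (color_class n k c i) \<Longrightarrow>
      card (shadow s C) \<le> M n r k t' s"
    using M_le_iff[OF assms(1,2), of t' s "M n r k t' s"] by auto
  have "card (shadow s C) \<le> M n r k t' s"
    if i: "i \<in> {1..r}" and C: "C \<in> tight_components t (color_class n k c i)" for i C
  proof -
    obtain D where D: "D \<in> tight_components t' (color_class n k c i)" "C \<subseteq> D"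
      using tight_component_antimono[OF _ C assms(3)] by auto
    have "D \<subseteq> complete_hypergraph n k"
      using tight_components_subset(1)[OF _ D(1)] by (auto simp: color_class_def)
    then show ?thesis
      using card_mono[OF finite_shadow shadow_mono[OF D(2)]] le[OF i D(1)] le_trans by blast
  qed
  then show ?thesis unfolding M_le_iff[OF assms(1,2)] using c by blast
qed

section \<open>Dominated vertices in two-colourings\<close>

text \<open>If \<open>E\<close> does not connect \<open>p\<^sub>0\<close> to \<open>q\<^sub>0\<close>, then \<open>F\<close> contains all edges between the \<open>E\<close>-component
  of \<open>p\<^sub>0\<close> and its complement, and a complete bipartite graph with nonempty sides is connected.\<close>

lemma connected_or_complement_connected:
  assumes cover: "\<And>p q. p \<in> W \<Longrightarrow> q \<in> W \<Longrightarrow> p \<noteq> q \<Longrightarrow> (p, q) \<in> E \<or> (p, q) \<in> F"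
    and "sym F"
  shows "(\<forall>p\<in>W. \<forall>q\<in>W. (p, q) \<in> E\<^sup>*) \<or> (\<forall>p\<in>W. \<forall>q\<in>W. (p, q) \<in> F\<^sup>*)"
proof (cases "\<forall>p\<in>W. \<forall>q\<in>W. (p, q) \<in> E\<^sup>*")
  case False
  then obtain p0 q0 where p0: "p0 \<in> W" "q0 \<in> W" "(p0, q0) \<notin> E\<^sup>*" by blast
  define X where "X = E\<^sup>* `` {p0}"
  have cross: "(x, y) \<in> F" if "x \<in> W" "x \<in> X" "y \<in> W" "y \<notin> X" for x y
    using that cover[of x y] by (auto simp: X_def intro: rtrancl_into_rtrancl)
  then have cross': "(y, x) \<in> F" if "x \<in> W" "x \<in> X" "y \<in> W" "y \<notin> X" for x y
    using that \<open>sym F\<close> by (meson symD)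
  have pq: "p0 \<in> X" "q0 \<notin> X" using p0 by (auto simp: X_def)
  have "(a, b) \<in> F\<^sup>*" if "a \<in> W" "b \<in> W" for a b
  proof (cases "a \<in> X"; cases "b \<in> X")
    assume "a \<in> X" "b \<in> X"
    then have "(a, q0) \<in> F" "(q0, b) \<in> F" using cross cross' that p0 pq by auto
    then show ?thesis by auto
  next
    assume "a \<notin> X" "b \<notin> X"
    then have "(a, p0) \<in> F" "(p0, b) \<in> F" using cross cross' that p0 pq by auto
    then show ?thesis by auto
  qed (use cross cross' that in auto)
  then show ?thesis by blast
qed auto

text \<open>Both conjuncts hold if colour \<open>i\<close> is connected and spanning in the link of \<open>v\<close>.  They are recorded
  in place of this connectedness because the components at different vertices are compared
  through them.\<close>

definition dominates :: "nat \<Rightarrow> (nat set \<Rightarrow> nat) \<Rightarrow> nat \<Rightarrow> nat \<Rightarrow> bool" where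
  "dominates n c i v \<longleftrightarrow>
     (\<forall>u<n. u \<noteq> v \<longrightarrow> (\<exists>e\<in>color_class n 3 c i. u \<in> e \<and> v \<in> e)) \<and>
     (\<forall>e\<in>color_class n 3 c i. \<forall>f\<in>color_class n 3 c i. v \<in> e \<longrightarrow> v \<in> f \<longrightarrow>
        (e, f) \<in> (tight_adj 2 (color_class n 3 c i))\<^sup>*)"

lemma color_classD:
  assumes "e \<in> color_class n k c i"
  shows "finite e" "card e = k" "e \<subseteq> {..<n}" "c e = i" "e \<in> complete_hypergraph n k"
  using assms complete_memD[of e n k] by (auto simp: color_class_def)

lemma tight_adj_two_pointsI:
  assumes "e \<in> color_class n k c i" "f \<in> color_class n k c i" "u \<noteq> v" "{u, v} \<subseteq> e \<inter> f"
  shows "(e, f) \<in> tight_adj 2 (color_class n k c i)"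
proof -
  have "card {u, v} \<le> card (e \<inter> f)"
    using assms(4) color_classD(1)[OF assms(1)] by (intro card_mono) auto
  then show ?thesis using assms by (simp add: tight_adj_def)
qed

text \<open>The relation \<open>E i\<close> in the proof is the colour \<open>i\<close> part of the link of \<open>v\<close>.  A path in it is a
  chain of triples in which consecutive ones share \<open>v\<close> and a vertex of the path.\<close>

lemma exists_dominating_color:
  assumes "3 \<le> n" "c \<in> colorings 2 (complete_hypergraph n 3)" "v < n"
  shows "\<exists>i\<in>{1..2}. dominates n c i v"
proof -
  define W where "W = {..<n} - {v}"
  define E where "E i = {(p, q). {v, p, q} \<in> color_class n 3 c i \<and> p \<noteq> v \<and> q \<noteq> v \<and> p \<noteq> q}" for i
  have "(p, q) \<in> E 1 \<or> (p, q) \<in> E 2" if "p \<in> W" "q \<in> W" "p \<noteq> q" for p q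
  proof -
    have "{v, p, q} \<in> complete_hypergraph n 3"
      using that assms(3) by (intro triple_in_complete) (auto simp: W_def)
    moreover from this have "c {v, p, q} \<in> {1..2}"
      using assms(2) by (auto simp: colorings_def)
    ultimately show ?thesis using that by (auto simp: E_def W_def color_class_def)
  qed
  moreover have "sym (E 2)" by (auto simp: sym_def E_def insert_commute)
  ultimately have "(\<forall>p\<in>W. \<forall>q\<in>W. (p, q) \<in> (E 1)\<^sup>*) \<or> (\<forall>p\<in>W. \<forall>q\<in>W. (p, q) \<in> (E 2)\<^sup>*)"
    by (rule connected_or_complement_connected)
  then have "\<exists>i\<in>{1..2}. \<forall>p\<in>W. \<forall>q\<in>W. (p, q) \<in> (E i)\<^sup>*"
  proof
    assume "\<forall>p\<in>W. \<forall>q\<in>W. (p, q) \<in> (E 1)\<^sup>*"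
    then show ?thesis by (intro bexI[of _ 1]) auto
  next
    assume "\<forall>p\<in>W. \<forall>q\<in>W. (p, q) \<in> (E 2)\<^sup>*"
    then show ?thesis by (intro bexI[of _ 2]) auto
  qed
  then obtain i where i: "i \<in> {1..2}" and conn: "\<And>p q. p \<in> W \<Longrightarrow> q \<in> W \<Longrightarrow> (p, q) \<in> (E i)\<^sup>*"
    by blast
  let ?H = "color_class n 3 c i"
  have link: "(e, f) \<in> (tight_adj 2 ?H)\<^sup>*"
    if "(p, q) \<in> (E i)\<^sup>*" "e \<in> ?H" "v \<in> e" "p \<in> e" "p \<noteq> v" "f \<in> ?H" "v \<in> f" "q \<in> f" "q \<noteq> v"
    for p q e f
    using that
  proof (induction arbitrary: f rule: rtrancl_induct)
    case base
    then show ?case by (intro r_into_rtrancl tight_adj_two_pointsI[of _ _ _ _ _ _ p v]) auto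
  next
    case (step q r)
    have g: "{v, q, r} \<in> ?H" "q \<noteq> v" using step.hyps(2) by (auto simp: E_def)
    then have "(e, {v, q, r}) \<in> (tight_adj 2 ?H)\<^sup>*" using step by auto
    moreover have "({v, q, r}, f) \<in> tight_adj 2 ?H"
      using step.prems g by (intro tight_adj_two_pointsI[of _ _ _ _ _ _ r v]) auto
    ultimately show ?case by auto
  qed
  have "\<exists>e\<in>?H. u \<in> e \<and> v \<in> e" if u: "u < n" "u \<noteq> v" for u
  proof -
    have "\<not> {..<n} \<subseteq> {u, v}" using card_mono[of "{u, v}" "{..<n}"] assms(1) u by auto
    then obtain w where w: "w < n" "w \<noteq> u" "w \<noteq> v" by auto
    then have "(u, w) \<in> (E i)\<^sup>*" using u by (intro conn) (auto simp: W_def)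
    then have "\<exists>z. (u, z) \<in> E i" by (rule converse_rtranclE) (use w in auto)
    then obtain z where "(u, z) \<in> E i" ..
    then have "{v, u, z} \<in> ?H" by (simp add: E_def)
    then show ?thesis by (intro bexI[of _ "{v, u, z}"]) auto
  qed
  moreover have "(e, f) \<in> (tight_adj 2 ?H)\<^sup>*"
    if "e \<in> ?H" "f \<in> ?H" "v \<in> e" "v \<in> f" for e f
  proof -
    have other: "\<exists>p\<in>e. p \<in> W" if "e \<in> ?H" for e
    proof (rule ccontr)
      assume "\<not> ?thesis"
      then have "e \<subseteq> {v}" using color_classD(3)[OF that] by (auto simp: W_def)
      then have "card e \<le> 1" using card_mono[of "{v}" e] by simp
      then show False using color_classD(2)[OF that] by simp
    qed
    obtain p q where pq: "p \<in> e" "p \<in> W" "q \<in> f" "q \<in> W"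
      using other[OF \<open>e \<in> ?H\<close>] other[OF \<open>f \<in> ?H\<close>] by blast
    then have "p \<noteq> v" "q \<noteq> v" by (auto simp: W_def)
    then show ?thesis using link[OF conn] pq that by blast
  qed
  ultimately have "dominates n c i v" by (simp add: dominates_def)
  then show ?thesis using i by blast
qed

lemma dominates_edge:
  assumes "dominates n c i v" "3 \<le> n" "u < n"
  obtains e where "e \<in> color_class n 3 c i" "u \<in> e" "v \<in> e"
proof (cases "u = v")
  case True
  have "\<not> {..<n} \<subseteq> {v}" using card_mono[of "{v}" "{..<n}"] assms(2) by auto
  then obtain w where "w < n" "w \<noteq> v" by auto
  then show ?thesis using assms(1) that True unfolding dominates_def by blast
qed (use assms that in \<open>auto simp: dominates_def\<close>)

text \<open>All vertices that one colour dominates share one component: a triple of this colour through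
  two of them, which domination provides, lies in both of their components.\<close>

lemma dominating_component:
  assumes "dominates n c i v" "v < n" "3 \<le> n"
  obtains C where "C \<in> tight_components 2 (color_class n 3 c i)"
    "\<And>e w. e \<in> color_class n 3 c i \<Longrightarrow> w \<in> e \<Longrightarrow> dominates n c i w \<Longrightarrow> e \<in> C"
proof -
  let ?H = "color_class n 3 c i"
  obtain e0 where e0: "e0 \<in> ?H" "v \<in> e0" using dominates_edge[OF assms(1,3,2)] by blast
  let ?C = "(tight_adj 2 ?H)\<^sup>* `` {e0}"
  have "e \<in> ?C" if e: "e \<in> ?H" "w \<in> e" "dominates n c i w" for e w
  proof -
    have "w < n" using color_classD(3)[OF e(1)] e(2) by auto
    then obtain g where g: "g \<in> ?H" "w \<in> g" "v \<in> g" using dominates_edge[OF assms(1,3)] by blast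
    have "(e0, g) \<in> (tight_adj 2 ?H)\<^sup>*" using assms(1) e0 g unfolding dominates_def by blast
    moreover have "(g, e) \<in> (tight_adj 2 ?H)\<^sup>*" using e g unfolding dominates_def by blast
    ultimately show ?thesis by auto
  qed
  then show ?thesis using that[of ?C] tight_component_of[OF _ e0(1)] by auto
qed

section \<open>Vertices and pairs\<close>

lemma M_vertices_ge:
  assumes "3 \<le> n"
  shows "n \<le> M n 2 3 2 1"
proof (rule M_geI)
  fix c assume c: "c \<in> colorings 2 (complete_hypergraph n 3)"
  have 0: "(0::nat) < n" using assms by simp
  obtain i where i: "i \<in> {1..2}" "dominates n c i 0"
    using exists_dominating_color[OF assms c 0] by blast
  obtain C where C: "C \<in> tight_components 2 (color_class n 3 c i)"
    and max: "\<And>e w. e \<in> color_class n 3 c i \<Longrightarrow> w \<in> e \<Longrightarrow> dominates n c i w \<Longrightarrow> e \<in> C"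
    using dominating_component[OF i(2) 0 assms] by metis
  have CC: "C \<subseteq> complete_hypergraph n 3"
    using tight_components_subset(1)[OF _ C] by (auto simp: color_class_def)
  have "(\<lambda>u. {u}) ` {..<n} \<subseteq> shadow 1 C"
  proof
    fix S assume "S \<in> (\<lambda>u. {u}) ` {..<n}"
    then obtain u where "u < n" and S: "S = {u}" by auto
    then obtain e where e: "e \<in> color_class n 3 c i" "u \<in> e" "0 \<in> e"
      using dominates_edge[OF i(2) assms] by blast
    have "e \<in> C" by (rule max[OF e(1,3) i(2)])
    then show "S \<in> shadow 1 C" using e(2) S by (auto simp: shadow_def)
  qed
  then have "n \<le> card (shadow 1 C)"
    using card_mono[OF finite_shadow[OF CC], of "(\<lambda>u. {u}) ` {..<n}"] by (simp add: card_image)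
  then show "\<exists>i\<in>{1..2}. \<exists>C\<in>tight_components 2 (color_class n 3 c i). n \<le> card (shadow 1 C)"
    using i C by blast
qed (use assms in auto)

lemma M_vertices_le:
  assumes "3 \<le> n"
  shows "M n 2 3 t 1 \<le> n"
proof (rule M_leI[where g = "\<lambda>_. 1"])
  fix i C assume "C \<in> tight_components t {e \<in> complete_hypergraph n 3. (1::nat) = i}"
  then have "C \<subseteq> {e \<in> complete_hypergraph n 3. (1::nat) = i}"
    by (rule tight_components_subset(1)[rotated]) simp
  then have "C \<subseteq> complete_hypergraph n 3" by blast
  then show "card (shadow 1 C) \<le> n" using card_shadow_le[of C n 3 1] by simp
qed (use assms in auto)

text \<open>A colour that dominates a set \<open>R\<close> of at least \<open>n - n div 2\<close> vertices has a component whose shadow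
  contains all pairs that meet \<open>R\<close>.\<close>

lemma M_pairs_ge:
  assumes "3 \<le> n"
  shows "(n choose 2) - ((n div 2) choose 2) \<le> M n 2 3 2 2"
proof (rule M_geI)
  fix c assume c: "c \<in> colorings 2 (complete_hypergraph n 3)"
  define R where "R i = {v \<in> {..<n}. dominates n c i v}" for i
  have "{1..2::nat} = {1, 2}" by auto
  then have "R 1 \<union> R 2 = {..<n}"
    using exists_dominating_color[OF assms c] by (auto simp: R_def)
  then have "n \<le> card (R 1) + card (R 2)" by (metis card_Un_le card_lessThan)
  then have "n - n div 2 \<le> card (R 1) \<or> n - n div 2 \<le> card (R 2)" by linarith
  then obtain i where i: "i \<in> {1..2}" "n - n div 2 \<le> card (R i)"
    using that[of 1] that[of 2] by auto
  then have "R i \<noteq> {}" using assms by (intro notI) simp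
  then obtain v where v: "v < n" "dominates n c i v" by (auto simp: R_def)
  obtain C where C: "C \<in> tight_components 2 (color_class n 3 c i)"
    and max: "\<And>e w. e \<in> color_class n 3 c i \<Longrightarrow> w \<in> e \<Longrightarrow> dominates n c i w \<Longrightarrow> e \<in> C"
    using dominating_component[OF v(2,1) assms] by metis
  have CC: "C \<subseteq> complete_hypergraph n 3"
    using tight_components_subset(1)[OF _ C] by (auto simp: color_class_def)
  have sub: "nsets {..<n} 2 - nsets ({..<n} - R i) 2 \<subseteq> shadow 2 C"
  proof
    fix S assume S: "S \<in> nsets {..<n} 2 - nsets ({..<n} - R i) 2"
    then obtain w where w: "w \<in> S" "w \<in> R i" by (auto simp: nsets_def)
    have "card S = 2" using S by (auto simp: nsets_def)
    then obtain x y where "S = {x, y}" "x \<noteq> y" by (auto simp: card_2_iff)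
    then obtain u where u: "S = {w, u}" "u \<noteq> w" using w(1) that[of x] that[of y] by auto
    then have "u < n" using S by (auto simp: nsets_def)
    moreover have dom: "dominates n c i w" using w by (simp add: R_def)
    ultimately obtain e where e: "e \<in> color_class n 3 c i" "u \<in> e" "w \<in> e"
      using dominates_edge assms by blast
    have "e \<in> C" by (rule max[OF e(1,3) dom])
    then show "S \<in> shadow 2 C"
      using e u \<open>card S = 2\<close> by (auto simp: shadow_def)
  qed
  have "card ({..<n} - R i) = n - card (R i)"
    by (subst card_Diff_subset) (auto simp: R_def)
  then have "card ({..<n} - R i) \<le> n div 2" using i(2) by linarith
  then have "card (nsets ({..<n} - R i) 2) \<le> (n div 2) choose 2"
    by (simp add: binomial_right_mono)
  moreover have "card (nsets {..<n} 2 - nsets ({..<n} - R i) 2) =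
      card (nsets {..<n} 2) - card (nsets ({..<n} - R i) 2)"
    by (rule card_Diff_subset) (auto simp: finite_imp_finite_nsets nsets_def)
  ultimately have "(n choose 2) - ((n div 2) choose 2) \<le> card (shadow 2 C)"
    using card_mono[OF finite_shadow[OF CC] sub] by (simp add: card_nsets)
  then show "\<exists>i\<in>{1..2}. \<exists>C\<in>tight_components 2 (color_class n 3 c i).
      (n choose 2) - ((n div 2) choose 2) \<le> card (shadow 2 C)"
    using i C by blast
qed (use assms in auto)

text \<open>The colouring gives each triple the colour of the half that contains at least two of its
  vertices.  Then already the shadows of the colour classes satisfy the bound.\<close>

lemma M_pairs_le:
  assumes "3 \<le> n"
  shows "M n 2 3 t 2 \<le> (n choose 2) - ((n div 2) choose 2)"
proof -
  define A where "A = {..<n div 2}"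
  define B where "B = {n div 2..<n}"
  define g where "g e = (if 2 \<le> card (e \<inter> B) then 1 else 2 :: nat)" for e
  \<comment> \<open>An edge with its majority on one side has at most one vertex on the other side \<open>X\<close>, so its
    shadow contains no pair inside \<open>X\<close>.\<close>
  have bound: "card (shadow 2 C) \<le> (n choose 2) - ((n div 2) choose 2)"
    if C: "C \<subseteq> complete_hypergraph n 3" and X: "X \<subseteq> {..<n}" "n div 2 \<le> card X"
      and inter: "\<And>e. e \<in> C \<Longrightarrow> card (e \<inter> X) \<le> 1" for C X
  proof -
    have fin: "finite X" using X finite_subset by blast
    have "shadow 2 C \<subseteq> nsets {..<n} 2 - nsets X 2"
    proof
      fix S assume S: "S \<in> shadow 2 C"
      then obtain e where e: "e \<in> C" "S \<subseteq> e" "card S = 2" by (auto simp: shadow_def)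
      have "S \<notin> nsets X 2"
      proof
        assume "S \<in> nsets X 2"
        then have "S \<subseteq> e \<inter> X" using e by (auto simp: nsets_def)
        then have "card S \<le> card (e \<inter> X)" using fin by (intro card_mono) auto
        then show False using inter[OF e(1)] e(3) by simp
      qed
      then show "S \<in> nsets {..<n} 2 - nsets X 2" using shadow_subset_nsets[OF C] S by blast
    qed
    then have "card (shadow 2 C) \<le> card (nsets {..<n} 2 - nsets X 2)"
      by (intro card_mono) (auto simp: finite_imp_finite_nsets)
    also have "\<dots> = card (nsets {..<n} 2) - card (nsets X 2)"
      using X fin by (intro card_Diff_subset nsets_mono) (auto simp: finite_imp_finite_nsets)
    also have "\<dots> \<le> (n choose 2) - ((n div 2) choose 2)"
      using X(2) by (simp add: binomial_right_mono diff_le_mono2)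
    finally show ?thesis .
  qed
  show ?thesis
  proof (rule M_leI[where g = g])
    fix i C assume "C \<in> tight_components t {e \<in> complete_hypergraph n 3. g e = i}"
    then have C: "C \<subseteq> {e \<in> complete_hypergraph n 3. g e = i}"
      by (rule tight_components_subset(1)[rotated]) simp
    have split: "card (e \<inter> A) + card (e \<inter> B) = 3" if "e \<in> C" for e
    proof -
      have e: "finite e" "card e = 3" "e \<subseteq> {..<n}" using C that complete_memD by blast+
      have "e = (e \<inter> A) \<union> (e \<inter> B)" "(e \<inter> A) \<inter> (e \<inter> B) = {}"
        using e(3) by (auto simp: A_def B_def)
      then show ?thesis using card_Un_disjoint[of "e \<inter> A" "e \<inter> B"] e by auto
    qed
    show "card (shadow 2 C) \<le> (n choose 2) - ((n div 2) choose 2)"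
    proof (cases "i = 1")
      case True
      have "card (e \<inter> A) \<le> 1" if "e \<in> C" for e
        using split[OF that] C that True by (auto simp: g_def split: if_splits)
      then show ?thesis using C by (intro bound[of C A]) (auto simp: A_def)
    next
      case False
      have "card (e \<inter> B) \<le> 1" if "e \<in> C" for e
        using C that False by (auto simp: g_def split: if_splits)
      then show ?thesis using C by (intro bound[of C B]) (auto simp: B_def)
    qed
  qed (use assms in \<open>auto simp: g_def\<close>)
qed

section \<open>Connected components with many edges\<close>

lemma Union_component_subset:
  assumes "C \<subseteq> complete_hypergraph n k"
  shows "\<Union>C \<subseteq> {..<n}" "finite (\<Union>C)" "C \<subseteq> nsets (\<Union>C) k"
proof -
  show sub: "\<Union>C \<subseteq> {..<n}" using assms complete_memD(3) by blast
  then show "finite (\<Union>C)" using finite_subset by blast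
  show "C \<subseteq> nsets (\<Union>C) k"
  proof
    fix e assume "e \<in> C"
    then show "e \<in> nsets (\<Union>C) k"
      using assms complete_memD(1,2)[of e n k] by (auto simp: nsets_def)
  qed
qed

lemma card_component_le_choose:
  assumes "C \<subseteq> complete_hypergraph n k"
  shows "card C \<le> card (\<Union>C) choose k"
  using card_mono[OF finite_imp_finite_nsets Union_component_subset(3)[OF assms]]
    Union_component_subset(2)[OF assms] by simp

lemma tight_component_color_class_subset:
  assumes "C \<in> tight_components t (color_class n k c i)"
  shows "C \<subseteq> complete_hypergraph n k"
  using tight_components_subset(1)[OF _ assms] by (auto simp: color_class_def)

text \<open>Here and below, \<open>3 - i\<close> is the colour other than \<open>i\<close>.\<close>

lemma card_color_classes:
  assumes "c \<in> colorings 2 (complete_hypergraph n k)" "i \<in> {1..2}"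
  shows "card (color_class n k c i) + card (color_class n k c (3 - i)) = n choose k"
proof -
  have "e \<in> color_class n k c i \<union> color_class n k c (3 - i)"
    if "e \<in> complete_hypergraph n k" for e
  proof -
    have "c e \<in> {1..2}" using assms(1) that by (auto simp: colorings_def)
    then have "c e = i \<or> c e = 3 - i" using assms(2) by auto
    then show ?thesis using that by (auto simp: color_class_def)
  qed
  then have "complete_hypergraph n k = color_class n k c i \<union> color_class n k c (3 - i)"
    by (auto simp: color_class_def)
  moreover have "i \<noteq> 3 - i" using assms(2) by (simp, presburger)
  then have "color_class n k c i \<inter> color_class n k c (3 - i) = {}"
    unfolding color_class_def by blast
  ultimately show ?thesis
    using card_Un_disjoint[of "color_class n k c i" "color_class n k c (3 - i)"] card_complete[of n k]
    by simp
qed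

lemma connected_components_disjoint:
  assumes "C \<in> tight_components 1 (color_class n k c i)"
    and "D \<in> tight_components 1 (color_class n k c i)" "C \<noteq> D"
  shows "\<Union>C \<inter> \<Union>D = {}"
proof (rule ccontr)
  assume "\<not> ?thesis"
  then obtain e f x where x: "e \<in> C" "f \<in> D" "x \<in> e \<inter> f" by blast
  have "finite e"
    using x(1) tight_component_color_class_subset[OF assms(1)] complete_memD(1) by blast
  then have "card (e \<inter> f) > 0" using x(3) by (subst card_gt_0_iff) auto
  then have "1 \<le> card (e \<inter> f)" by simp
  then show False
    using tight_components_eqI[OF finite_color_class assms(1,2) x(1,2)] assms(3) by blast
qed

text \<open>Every edge contains some vertex \<open>u\<close>, and domination provides an edge through \<open>u\<close> in the
  component at \<open>v\<close>.\<close>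

lemma dominated_color_class_connected:
  assumes "dominates n c i v" "v < n" "3 \<le> n"
  shows "color_class n 3 c i \<in> tight_components 1 (color_class n 3 c i)"
proof -
  let ?H = "color_class n 3 c i"
  obtain e0 where e0: "e0 \<in> ?H" "v \<in> e0" using dominates_edge[OF assms(1,3,2)] by blast
  obtain C where C: "C \<in> tight_components 2 ?H"
    and max: "\<And>e w. e \<in> ?H \<Longrightarrow> w \<in> e \<Longrightarrow> dominates n c i w \<Longrightarrow> e \<in> C"
    using dominating_component[OF assms] by metis
  obtain D where D: "D \<in> tight_components 1 ?H" "C \<subseteq> D"
    using tight_component_antimono[OF finite_color_class C, of 1] by auto
  have "e \<in> D" if e: "e \<in> ?H" for e
  proof -
    have "e \<noteq> {}" using color_classD(2)[OF e] by auto
    then obtain u where u: "u \<in> e" by blast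
    then have "u < n" using color_classD(3)[OF e] by auto
    then obtain f where f: "f \<in> ?H" "u \<in> f" "v \<in> f" using dominates_edge[OF assms(1,3)] by blast
    have "card (f \<inter> e) > 0"
      using color_classD(1)[OF e] u f(2) by (subst card_gt_0_iff) auto
    then have 1: "1 \<le> card (f \<inter> e)" by simp
    have "f \<in> D" using max[OF f(1,3) assms(1)] D(2) by blast
    moreover have "e \<in> (tight_adj 1 ?H)\<^sup>* `` {e}" by simp
    ultimately have "D = (tight_adj 1 ?H)\<^sup>* `` {e}"
      using tight_components_eqI[OF finite_color_class D(1) tight_component_of[OF finite_color_class e] _ _ 1]
      by blast
    then show ?thesis by simp
  qed
  then have "D = ?H" using tight_components_subset(1)[OF finite_color_class D(1)] by blast
  then show ?thesis using D(1) by simp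
qed

text \<open>The value \<open>x\<close> with \<open>x\<^sup>3 = 3 x (1 - x)\<close>: when the vertices are split in the ratio \<open>x : 1 - x\<close>, the
  triples inside the larger part are asymptotically as many as the crossing triples.\<close>

definition critical_ratio :: real where
  "critical_ratio = (sqrt 21 - 3) / 2"

lemma critical_ratio_eq: "critical_ratio\<^sup>2 = 3 - 3 * critical_ratio"
  unfolding critical_ratio_def by (simp add: power2_eq_square field_simps)

lemma critical_ratio_bounds: "79 / 100 < critical_ratio" "critical_ratio < 4 / 5"
proof -
  have "sqrt (458\<^sup>2 / 100\<^sup>2) < sqrt 21" "sqrt 21 < sqrt ((46 / 10)\<^sup>2)"
    by (intro real_sqrt_less_mono; simp add: power2_eq_square)+
  then show "79 / 100 < critical_ratio" "critical_ratio < 4 / 5"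
    by (simp_all add: critical_ratio_def real_sqrt_divide)
qed

lemma critical_value_eq: "6 * sqrt 21 - 27 = 3 * critical_ratio * (1 - critical_ratio)"
  using critical_ratio_eq by (simp add: critical_ratio_def power2_eq_square algebra_simps field_simps)

lemma critical_value_cube: "critical_ratio ^ 3 = 6 * sqrt 21 - 27"
proof -
  have "critical_ratio ^ 3 = critical_ratio * critical_ratio\<^sup>2"
    by (simp add: power3_eq_cube power2_eq_square)
  also have "\<dots> = 6 * sqrt 21 - 27"
    unfolding critical_ratio_eq critical_value_eq by (simp add: algebra_simps)
  finally show ?thesis .
qed

lemma critical_value_complement: "2 * (6 * sqrt 21 - 27) = 1 - (1 - critical_ratio) ^ 3"
proof -
  have "1 - (1 - critical_ratio) ^ 3 = critical_ratio ^ 3 + 3 * critical_ratio * (1 - critical_ratio)"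
    by (simp add: power3_eq_cube algebra_simps)
  then show ?thesis using critical_value_cube critical_value_eq by simp
qed

lemma critical_value_bound: "6 * sqrt 21 - 27 < 3 / 4"
proof -
  have "sqrt 21 < sqrt ((46 / 10)\<^sup>2)" by (intro real_sqrt_less_mono) (simp add: power2_eq_square)
  then show ?thesis by simp
qed

text \<open>Let \<open>y = q n\<close> be the number of vertices of a component \<open>D\<close> of the other colour with the most
  vertices.  Large, medium and small values of \<open>q\<close> are excluded by different counts.  For large \<open>q\<close>,
  the dominating colour and \<open>D\<close> contain all triples except some that avoid the vertices of \<open>D\<close>.  For
  medium \<open>q\<close>, the dominating colour contains the crossing triples.  For small \<open>q\<close>, the other colour
  has at most a quarter of all triples, since \<open>\<Sum> z\<^sup>3 \<le> (1/4) \<Sum> z\<close> for relative sizes \<open>z \<le> 1/2\<close>.\<close>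

lemma connected_component_ge:
  assumes n: "3 \<le> n" and c: "c \<in> colorings 2 (complete_hypergraph n 3)"
  shows "\<exists>i\<in>{1..2}. \<exists>C\<in>tight_components 1 (color_class n 3 c i).
    (6 * sqrt 21 - 27) * real (n choose 3) \<le> real (card C)"
proof (rule ccontr)
  assume neg: "\<not> ?thesis"
  define N where "N = real (n choose 3)"
  define \<theta> :: real where "\<theta> = 6 * sqrt 21 - 27"
  have small: "real (card C) < \<theta> * N"
    if "i \<in> {1..2}" "C \<in> tight_components 1 (color_class n 3 c i)" for i C
    using neg that unfolding N_def \<theta>_def by force
  have Npos: "0 < N" using n by (simp add: N_def)
  have "0 < n" using n by simp
  then obtain i where i: "i \<in> {1..2}" "dominates n c i 0"
    using exists_dominating_color[OF n c] by blast
  let ?H = "color_class n 3 c i" and ?J = "color_class n 3 c (3 - i)"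
  let ?T = "tight_components 1 ?J"
  have j: "3 - i \<in> {1..2}" using i(1) by auto
  have H: "real (card ?H) < \<theta> * N"
    using small[OF i(1)] dominated_color_class_connected[OF i(2) _ n] n by simp
  have HJ: "real (card ?H) + real (card ?J) = N"
    using card_color_classes[OF c i(1)] unfolding N_def by (metis of_nat_add)
  have "?T \<noteq> {}"
  proof
    assume "?T = {}"
    then have "card ?J = 0" using card_eq_sum_tight_components[of ?J 1] by simp
    then have "N < \<theta> * N" using H HJ by simp
    then show False using Npos critical_value_bound by (simp add: \<theta>_def)
  qed
  moreover have fin: "finite ?T" by (simp add: finite_tight_components)
  ultimately have "Max ((\<lambda>C. card (\<Union>C)) ` ?T) \<in> (\<lambda>C. card (\<Union>C)) ` ?T"
    by (intro Max_in) auto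
  then obtain D where D: "D \<in> ?T" and "Max ((\<lambda>C. card (\<Union>C)) ` ?T) = card (\<Union>D)" by (rule imageE)
  then have D_max: "card (\<Union>C) \<le> card (\<Union>D)" if "C \<in> ?T" for C
    using Max_ge[of "(\<lambda>C. card (\<Union>C)) ` ?T" "card (\<Union>C)"] fin that by simp
  have sub: "C \<subseteq> complete_hypergraph n 3" if "C \<in> ?T" for C
    using tight_component_color_class_subset[OF that] .
  define y where "y = card (\<Union>D)"
  have "y \<le> n"
    using card_mono[OF _ Union_component_subset(1)[OF sub[OF D]]] by (simp add: y_def)
  have "?J - D \<subseteq> nsets ({..<n} - \<Union>D) 3"
  proof
    fix f assume f: "f \<in> ?J - D"
    then have "f \<in> \<Union>?T" using Union_tight_components[of ?J 1] by simp
    then obtain C where C: "C \<in> ?T" "f \<in> C" by blast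
    then have "\<Union>C \<inter> \<Union>D = {}" using connected_components_disjoint[OF C(1) D] f by blast
    then show "f \<in> nsets ({..<n} - \<Union>D) 3"
      using C(2) f color_classD(1-3)[of f n 3 c "3 - i"] by (auto simp: nsets_def)
  qed
  then have "card (?J - D) \<le> card (nsets ({..<n} - \<Union>D) 3)"
    by (intro card_mono finite_imp_finite_nsets) auto
  then have "card (?J - D) \<le> card ({..<n} - \<Union>D) choose 3" by simp
  moreover have "card ({..<n} - \<Union>D) = n - y"
    using Union_component_subset(1,2)[OF sub[OF D]] by (simp add: card_Diff_subset y_def)
  moreover have "card (?J - D) = card ?J - card D" "card D \<le> card ?J"
    using tight_components_subset(1)[OF _ D] finite_subset[of D ?J]
    by (simp_all add: card_Diff_subset card_mono)
  ultimately have "card ?J \<le> card D + ((n - y) choose 3)"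
    by (simp add: le_diff_conv add.commute)
  then have J: "real (card ?J) \<le> real (card D) + real ((n - y) choose 3)"
    by (metis of_nat_add of_nat_le_iff)
  have D_le: "real (card D) \<le> real (y choose 3)"
    using card_component_le_choose[OF sub[OF D]] by (simp add: y_def)
  define q where "q = real y / real n"
  have q: "0 \<le> q" "q \<le> 1" using \<open>y \<le> n\<close> n by (auto simp: q_def field_simps)
  consider "critical_ratio \<le> q" | "1 / 2 \<le> q" "q \<le> critical_ratio" | "q \<le> 1 / 2" by linarith
  then show False
  proof cases
    case 1
    have "real ((n - y) choose 3) \<le> (real (n - y) / real n) ^ 3 * N"
      unfolding N_def by (rule choose_three_le) simp
    also have "real (n - y) / real n = 1 - q"
      using \<open>y \<le> n\<close> n by (simp add: q_def field_simps of_nat_diff)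
    also have "(1 - q) ^ 3 * N \<le> (1 - critical_ratio) ^ 3 * N"
      using 1 q Npos by (intro mult_right_mono power_mono) auto
    finally have "N < 2 * \<theta> * N + (1 - critical_ratio) ^ 3 * N"
      using J H HJ small[OF j D] by linarith
    also have "\<dots> = (2 * \<theta> + (1 - critical_ratio) ^ 3) * N" by (simp only: distrib_right)
    also have "2 * \<theta> + (1 - critical_ratio) ^ 3 = 1"
      using critical_value_complement by (simp add: \<theta>_def)
    finally show False by simp
  next
    case 2
    have "\<theta> \<le> 3 * q * (1 - q)"
    proof -
      have "0 \<le> (critical_ratio - q) * (critical_ratio + q - 1)"
        using 2 critical_ratio_bounds by (intro mult_nonneg_nonneg) auto
      then show ?thesis unfolding \<theta>_def critical_value_eq by (simp add: algebra_simps)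
    qed
    then have "\<theta> * N \<le> 3 * q * (1 - q) * N" using Npos by (intro mult_right_mono) auto
    also have "\<dots> \<le> 3 * q * (1 - q) * (real n ^ 2 * (real n - 2) / 6)"
      using q n unfolding N_def real_choose_three power2_eq_square
      by (intro mult_left_mono divide_right_mono mult_right_mono mult_nonneg_nonneg) auto
    also have "\<dots> = real y * real (n - y) * (real n - 2) / 2"
      using \<open>y \<le> n\<close> n by (simp add: q_def of_nat_diff power2_eq_square field_simps)
    also have "\<dots> = N - real (y choose 3) - real ((n - y) choose 3)"
      unfolding N_def using choose_three_split[of n y "n - y"] \<open>y \<le> n\<close> by simp
    also have "\<dots> \<le> real (card ?H)" using J D_le HJ by linarith
    finally show False using H by simp
  next
    case 3
    have "card (\<Union>C\<in>?T. \<Union>C) = (\<Sum>C\<in>?T. card (\<Union>C))"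
      using connected_components_disjoint Union_component_subset(2)[OF sub]
      by (intro card_UN_disjoint) (auto simp: finite_tight_components)
    moreover have "(\<Union>C\<in>?T. \<Union>C) \<subseteq> {..<n}" using Union_component_subset(1)[OF sub] by blast
    ultimately have "(\<Sum>C\<in>?T. card (\<Union>C)) \<le> n"
      by (metis card_lessThan card_mono finite_lessThan)
    then have total: "(\<Sum>C\<in>?T. real (card (\<Union>C))) \<le> real n"
      by (metis of_nat_le_iff of_nat_sum)
    have each: "real (card C) \<le> real (card (\<Union>C)) * (N / (4 * real n))" if C: "C \<in> ?T" for C
    proof -
      define z where "z = real (card (\<Union>C)) / real n"
      have "card (\<Union>C) \<le> y" using D_max[OF C] by (simp add: y_def)
      then have z: "0 \<le> z" "z \<le> 1 / 2"
        using 3 n by (auto simp: z_def q_def field_simps)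
      have "real (card C) \<le> real (card (\<Union>C) choose 3)"
        using card_component_le_choose[OF sub[OF C]] by simp
      also have "\<dots> \<le> z ^ 3 * N"
        unfolding N_def z_def
        using \<open>card (\<Union>C) \<le> y\<close> \<open>y \<le> n\<close> by (intro choose_three_le) simp
      also have "z ^ 3 \<le> z * (1 / 4)"
      proof -
        have "z * (z * z) \<le> z * (1 / 2 * (1 / 2))"
          using z by (intro mult_left_mono mult_mono) auto
        then show ?thesis by (simp add: power3_eq_cube)
      qed
      finally show ?thesis using Npos n by (simp add: z_def field_simps)
    qed
    have "real (card ?J) = (\<Sum>C\<in>?T. real (card C))"
      using card_eq_sum_tight_components[of ?J 1] by simp
    also have "\<dots> \<le> (\<Sum>C\<in>?T. real (card (\<Union>C)) * (N / (4 * real n)))"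
      by (rule sum_mono) (rule each)
    also have "\<dots> = (\<Sum>C\<in>?T. real (card (\<Union>C))) * (N / (4 * real n))"
      by (simp only: sum_distrib_right)
    also have "\<dots> \<le> real n * (N / (4 * real n))"
      using total Npos by (intro mult_right_mono) auto
    also have "\<dots> = N / 4" using n by simp
    finally have "3 / 4 * N < \<theta> * N" using H HJ by linarith
    then show False using critical_value_bound Npos by (simp add: \<theta>_def)
  qed
qed

lemma M_connected_edges_ge:
  assumes "3 \<le> n"
  shows "(6 * sqrt 21 - 27) * real (n choose 3) \<le> real (M n 2 3 1 3)"
proof -
  have "nat \<lceil>(6 * sqrt 21 - 27) * real (n choose 3)\<rceil> \<le> M n 2 3 1 3"
  proof (rule M_geI)
    fix c assume "c \<in> colorings 2 (complete_hypergraph n 3)"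
    then obtain i C where i: "i \<in> {1..2}" and C: "C \<in> tight_components 1 (color_class n 3 c i)"
      and le: "(6 * sqrt 21 - 27) * real (n choose 3) \<le> real (card C)"
      using connected_component_ge[OF assms] by blast
    have "shadow 3 C = C" using tight_component_color_class_subset[OF C] by (rule shadow_self)
    then have "nat \<lceil>(6 * sqrt 21 - 27) * real (n choose 3)\<rceil> \<le> card (shadow 3 C)"
      using le by (simp add: nat_le_iff ceiling_le_iff)
    then show "\<exists>i\<in>{1..2}. \<exists>C\<in>tight_components 1 (color_class n 3 c i).
        nat \<lceil>(6 * sqrt 21 - 27) * real (n choose 3)\<rceil> \<le> card (shadow 3 C)"
      using i C by blast
  qed (use assms in auto)
  then show ?thesis by (simp add: nat_le_iff ceiling_le_iff)
qed

text \<open>One colour consists of the triples inside one of the two parts, which form separate components;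
  the other colour consists of the crossing triples.\<close>

lemma M_connected_edges_le:
  assumes n: "3 \<le> n" and ab: "n = a + b"
    and "real (a choose 3) \<le> K" "real (b choose 3) \<le> K"
    and "real (n choose 3) - real (a choose 3) - real (b choose 3) \<le> K"
  shows "real (M n 2 3 1 3) \<le> K"
proof -
  define A where "A = {..<a}"
  define B where "B = {a..<n}"
  define g where "g e = (if e \<subseteq> A \<or> e \<subseteq> B then 1 else 2 :: nat)" for e
  have AB: "card A = a" "card B = b" "finite A" "finite B" "A \<inter> B = {}"
    using ab by (auto simp: A_def B_def)
  have sub: "nsets A 3 \<subseteq> complete_hypergraph n 3" "nsets B 3 \<subseteq> complete_hypergraph n 3"
    using ab unfolding complete_hypergraph_def
    by (intro nsets_mono; auto simp: A_def B_def)+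
  have nonempty: "e \<noteq> {}" if "e \<in> complete_hypergraph n 3" for e
    using complete_memD(2)[OF that] by auto
  have "M n 2 3 1 3 \<le> nat \<lfloor>K\<rfloor>"
  proof (rule M_leI[where g = g])
    fix i C assume i: "i \<in> {1..2}" and C: "C \<in> tight_components 1 {e \<in> complete_hypergraph n 3. g e = i}"
    have CC: "C \<subseteq> {e \<in> complete_hypergraph n 3. g e = i}"
      using C by (rule tight_components_subset(1)[rotated]) simp
    have "real (card C) \<le> K"
    proof (cases "i = 1")
      case True
      have lab: "(e \<subseteq> A) = (f \<subseteq> A)"
        if "e \<in> {e \<in> complete_hypergraph n 3. g e = i}" "f \<in> {e \<in> complete_hypergraph n 3. g e = i}"
          "1 \<le> card (e \<inter> f)" for e f
      proof -
        have "e \<inter> f \<noteq> {}" using that(3) by auto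
        then obtain x where x: "x \<in> e" "x \<in> f" by blast
        have "(h \<subseteq> A) = (x \<in> A)" if "x \<in> h" "g h = 1" for h
        proof -
          have "h \<subseteq> A \<or> h \<subseteq> B" using that(2) by (simp add: g_def split: if_splits)
          then show ?thesis using that(1) AB(5) by (metis disjoint_iff subset_iff)
        qed
        then show ?thesis using x that(1,2) True by simp
      qed
      obtain e where e: "e \<in> {e \<in> complete_hypergraph n 3. g e = i}"
        "C \<subseteq> {f \<in> {e \<in> complete_hypergraph n 3. g e = i}. (f \<subseteq> A) = (e \<subseteq> A)}"
        by (rule tight_component_label[OF _ C, of "\<lambda>e. e \<subseteq> A"])
          (simp, rule lab, assumption+)
      have in1: "f \<subseteq> A \<or> f \<subseteq> B" if "f \<in> C" for f
      proof -
        have "g f = 1" using that CC True by blast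
        then show ?thesis by (simp add: g_def split: if_splits)
      qed
      show ?thesis
      proof (cases "e \<subseteq> A")
        case True
        then have "C \<subseteq> nsets A 3" using e(2) by (auto simp: nsets_def complete_hypergraph_def)
        then have "card C \<le> a choose 3"
          using card_mono[of "nsets A 3" C] AB by (simp add: finite_imp_finite_nsets)
        then show ?thesis using assms(3) by linarith
      next
        case False
        then have "f \<subseteq> B" if "f \<in> C" for f using e(2) in1[OF that] that by blast
        then have "C \<subseteq> nsets B 3"
          using e(2) by (auto simp: nsets_def complete_hypergraph_def)
        then have "card C \<le> b choose 3"
          using card_mono[of "nsets B 3" C] AB by (simp add: finite_imp_finite_nsets)
        then show ?thesis using assms(4) by linarith
      qed
    next
      case False
      have "C \<subseteq> complete_hypergraph n 3 - (nsets A 3 \<union> nsets B 3)"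
      proof
        fix f assume "f \<in> C"
        then have "f \<in> complete_hypergraph n 3" "g f \<noteq> 1" using CC False by blast+
        then show "f \<in> complete_hypergraph n 3 - (nsets A 3 \<union> nsets B 3)"
          by (simp add: g_def nsets_def split: if_splits)
      qed
      then have "card C \<le> card (complete_hypergraph n 3 - (nsets A 3 \<union> nsets B 3))"
        by (intro card_mono) auto
      also have "\<dots> = (n choose 3) - card (nsets A 3 \<union> nsets B 3)"
        using sub AB by (subst card_Diff_subset) (simp_all add: card_complete finite_imp_finite_nsets)
      also have "card (nsets A 3 \<union> nsets B 3) = (a choose 3) + (b choose 3)"
      proof -
        have "e = {}" if "e \<in> nsets A 3" "e \<in> nsets B 3" for e
          using that AB(5) by (auto simp: nsets_def)
        then have "nsets A 3 \<inter> nsets B 3 = {}" using nonempty sub(1) by blast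
        then show ?thesis using AB by (subst card_Un_disjoint) (auto simp: finite_imp_finite_nsets)
      qed
      finally have "card C \<le> (n choose 3) - ((a choose 3) + (b choose 3))" .
      moreover have "real (n choose 3) - real (a choose 3) - real (b choose 3) \<ge> 0"
        unfolding choose_three_split[OF ab] using n by simp
      ultimately show ?thesis using assms(5) by linarith
    qed
    moreover have "shadow 3 C = C" using CC by (intro shadow_self[of C n]) auto
    ultimately show "card (shadow 3 C) \<le> nat \<lfloor>K\<rfloor>" by (simp add: le_nat_floor)
  qed (use n in \<open>auto simp: g_def\<close>)
  moreover have "0 \<le> K" using assms(3) by (meson of_nat_0_le_iff order_trans)
  ultimately show ?thesis by linarith
qed

lemma M_connected_edges_tendsto:
  "(\<lambda>n. real (M n 2 3 1 3) / real (n choose 3)) \<longlonglongrightarrow> 6 * sqrt 21 - 27"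
proof (rule tendsto_sandwich)
  let ?x = critical_ratio
  show "(\<lambda>n. 6 * sqrt 21 - 27) \<longlonglongrightarrow> 6 * sqrt 21 - 27" by simp
  show "\<forall>\<^sub>F n in sequentially. 6 * sqrt 21 - 27 \<le> real (M n 2 3 1 3) / real (n choose 3)"
    using eventually_ge_at_top[of 3]
  proof eventually_elim
    case (elim n)
    then show ?case using M_connected_edges_ge[OF elim] by (simp add: pos_le_divide_eq)
  qed
  define r where "r n = 3 * ?x * ((1 - ?x) * real n + 1) / (real n - 1)" for n :: nat
  show "\<forall>\<^sub>F n in sequentially. real (M n 2 3 1 3) / real (n choose 3) \<le> r n"
    using eventually_ge_at_top[of 3]
  proof eventually_elim
    case (elim n)
    \<comment> \<open>Rounding \<open>a\<close> down can make \<open>b\<close> exceed its ideal size by at most one, which is the summand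
      1 in \<open>r\<close>.\<close>
    define a where "a = nat \<lfloor>?x * real n\<rfloor>"
    define b where "b = n - a"
    have x: "1 / 2 < ?x" "?x < 1" using critical_ratio_bounds by auto
    then have a: "real a \<le> ?x * real n" "?x * real n - 1 \<le> real a"
      unfolding a_def using elim mult_nonneg_nonneg[of ?x "real n"] by linarith+
    have "?x * real n \<le> real n" using x by (simp add: mult_left_le_one_le)
    then have "a \<le> n" using a(1) by linarith
    then have ab: "n = a + b" by (simp add: b_def)
    have b: "real b \<le> (1 - ?x) * real n + 1" using a(2) ab by (simp add: algebra_simps)
    let ?N = "real (n choose 3)"
    have N: "0 < ?N" using elim by simp
    have r: "r n * ?N = (?x * real n) * ((1 - ?x) * real n + 1) * (real n - 2) / 2"
      using elim unfolding r_def real_choose_three by (simp add: field_simps)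
    have K: "real (m choose 3) \<le> r n * ?N" if m: "real m \<le> ?x * real n" "m \<le> n" for m
    proof -
      have cube: "?x ^ 3 = 3 * ?x * (1 - ?x)" using critical_value_cube critical_value_eq by simp
      have "1 - ?x \<le> ((1 - ?x) * real n + 1) / (real n - 1)"
        using elim x by (subst pos_le_divide_eq) (auto simp: algebra_simps)
      then have "3 * ?x * (1 - ?x) \<le> r n"
        unfolding r_def times_divide_eq_right[symmetric] using x by (intro mult_left_mono) auto
      then have "?x ^ 3 * ?N \<le> r n * ?N" unfolding cube using N by (intro mult_right_mono) auto
      moreover have "(real m / real n) ^ 3 * ?N \<le> ?x ^ 3 * ?N"
        using m(1) elim N by (intro mult_right_mono power_mono) (auto simp: field_simps)
      ultimately show ?thesis using choose_three_le[OF m(2)] by linarith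
    qed
    have "1 \<le> (2 * ?x - 1) * real n"
    proof -
      have "(1 / 2) * 3 \<le> (2 * ?x - 1) * real n"
        using critical_ratio_bounds elim by (intro mult_mono) auto
      then show ?thesis by simp
    qed
    then have "real b \<le> ?x * real n" using b by (simp add: algebra_simps)
    then have K1: "real (a choose 3) \<le> r n * ?N" and K2: "real (b choose 3) \<le> r n * ?N"
      using K[of a] K[of b] a(1) ab by simp_all
    have K3: "?N - real (a choose 3) - real (b choose 3) \<le> r n * ?N"
      unfolding r choose_three_split[OF ab] using a b elim x
      by (intro divide_right_mono mult_right_mono mult_mono) auto
    have "real (M n 2 3 1 3) \<le> r n * ?N"
      using M_connected_edges_le[OF elim ab K1 K2 K3] .
    then show ?case using N by (simp add: pos_divide_le_eq)
  qed
  have "(\<lambda>n. 3 * ?x * ((1 - ?x) + 1 / real n) / (1 - 1 / real n)) \<longlonglongrightarrow> 3 * ?x * ((1 - ?x) + 0) / (1 - 0)"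
    by (intro tendsto_intros lim_1_over_n) auto
  moreover have "\<forall>\<^sub>F n in sequentially. 3 * ?x * ((1 - ?x) + 1 / real n) / (1 - 1 / real n) = r n"
    using eventually_ge_at_top[of 2]
    by eventually_elim (simp add: r_def field_simps)
  ultimately show "r \<longlonglongrightarrow> 6 * sqrt 21 - 27"
    unfolding critical_value_eq using Lim_transform_eventually by fastforce
qed

section \<open>Blow-ups and the existence of the limit\<close>

text \<open>In the blow-up, \<open>x div m\<close> is the vertex to whose class \<open>x\<close> belongs, and each class has at most
  \<open>m\<close> elements.\<close>

lemma card_transversals_le:
  assumes "card k = 3"
  shows "card {f \<in> complete_hypergraph N 3. (\<lambda>x. x div m) ` f = k} \<le> m ^ 3"
proof -
  define F where "F v = {v * m..<v * m + m}" for v :: nat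
  obtain a b d where k: "k = {a, b, d}" "a \<noteq> b" "a \<noteq> d" "b \<noteq> d"
    using assms by (auto simp: card_3_iff)
  have F: "x \<in> F (x div m)" if "0 < m" for x
    using that div_mult_mod_eq[of x m] mod_less_divisor[OF that, of x] unfolding F_def
    by (metis atLeastLessThan_iff le_add1 nat_add_left_cancel_less)
  show ?thesis
  proof (cases "m = 0")
    case True
    have "{f \<in> complete_hypergraph N 3. (\<lambda>x. x div m) ` f = k} = {}"
    proof (rule equals0I)
      fix f assume "f \<in> {f \<in> complete_hypergraph N 3. (\<lambda>x. x div m) ` f = k}"
      then have "k \<subseteq> {0}" using True by auto
      then show False using k by auto
    qed
    then show ?thesis by (simp only: card.empty le0)
  next
    case False
    have "{f \<in> complete_hypergraph N 3. (\<lambda>x. x div m) ` f = k}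
        \<subseteq> (\<lambda>(x, y, z). {x, y, z}) ` (F a \<times> F b \<times> F d)"
    proof
      fix f assume "f \<in> {f \<in> complete_hypergraph N 3. (\<lambda>x. x div m) ` f = k}"
      then have f: "finite f" "card f = 3" "(\<lambda>x. x div m) ` f = {a, b, d}"
        using complete_memD k by auto
      have "a \<in> (\<lambda>x. x div m) ` f" "b \<in> (\<lambda>x. x div m) ` f" "d \<in> (\<lambda>x. x div m) ` f"
        using f(3) by simp_all
      then obtain x y z where xyz: "x \<in> f" "x div m = a" "y \<in> f" "y div m = b" "z \<in> f" "z div m = d"
        by auto
      have "x \<noteq> y" "x \<noteq> z" "y \<noteq> z" using k(2-4) xyz(2,4,6) by blast+
      then have "card {x, y, z} = 3" by simp
      then have "{x, y, z} = f" using f xyz by (intro card_subset_eq) auto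
      moreover have "(x, y, z) \<in> F a \<times> F b \<times> F d"
        using F[of x] F[of y] F[of z] xyz False by auto
      ultimately show "f \<in> (\<lambda>(x, y, z). {x, y, z}) ` (F a \<times> F b \<times> F d)"
        by (metis (no_types, lifting) case_prod_conv imageI)
    qed
    then have "card {f \<in> complete_hypergraph N 3. (\<lambda>x. x div m) ` f = k}
        \<le> card ((\<lambda>(x, y, z). {x, y, z}) ` (F a \<times> F b \<times> F d))"
      by (intro card_mono finite_imageI) (simp_all add: F_def)
    also have "\<dots> \<le> card (F a \<times> F b \<times> F d)"
      by (intro card_image_le) (simp add: F_def)
    also have "\<dots> = m ^ 3" by (simp add: F_def card_cartesian_product power3_eq_cube)
    finally show ?thesis .
  qed
qed

text \<open>A degenerate triple is determined by two vertices of one class and an arbitrary third vertex, so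
  there are few of them when \<open>N\<close> is about \<open>n m\<close> and \<open>n\<close> is large.\<close>

lemma card_degenerate_le:
  assumes "0 < m"
  shows "card {f \<in> complete_hypergraph N 3. \<not> inj_on (\<lambda>x. x div m) f} \<le> N\<^sup>2 * m"
proof -
  define F where "F v = {v * m..<v * m + m}" for v :: nat
  define T where "T = (SIGMA x:{..<N}. F (x div m) \<times> {..<N})"
  have F: "x \<in> F (x div m)" for x
    using assms div_mult_mod_eq[of x m] mod_less_divisor[OF assms, of x] unfolding F_def
    by (metis atLeastLessThan_iff le_add1 nat_add_left_cancel_less)
  have "finite T" by (simp add: T_def F_def)
  have "{f \<in> complete_hypergraph N 3. \<not> inj_on (\<lambda>x. x div m) f} \<subseteq> (\<lambda>(x, y, z). {x, y, z}) ` T"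
  proof
    fix f assume "f \<in> {f \<in> complete_hypergraph N 3. \<not> inj_on (\<lambda>x. x div m) f}"
    then have fN: "f \<in> complete_hypergraph N 3" and deg: "\<not> inj_on (\<lambda>x. x div m) f" by blast+
    note f = complete_memD[OF fN]
    from deg obtain x y where xy: "x \<in> f" "y \<in> f" "x \<noteq> y" "x div m = y div m"
      unfolding inj_on_def by blast
    have "card (f - {x, y}) = 1" using f xy by (subst card_Diff_subset) auto
    then obtain z where z: "f - {x, y} = {z}" by (auto simp: card_1_singleton_iff)
    have "f = {x, y, z}" using z xy by blast
    moreover have "(x, y, z) \<in> T" using xy z f(3) F[of y] unfolding T_def by auto
    ultimately show "f \<in> (\<lambda>(x, y, z). {x, y, z}) ` T"
      by (metis (no_types, lifting) case_prod_conv imageI)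
  qed
  then have "card {f \<in> complete_hypergraph N 3. \<not> inj_on (\<lambda>x. x div m) f}
      \<le> card ((\<lambda>(x, y, z). {x, y, z}) ` T)"
    using \<open>finite T\<close> by (intro card_mono finite_imageI)
  also have "\<dots> \<le> card T" by (rule card_image_le) (fact \<open>finite T\<close>)
  also have "card T = (\<Sum>x<N. card (F (x div m) \<times> {..<N}))"
    unfolding T_def by (subst card_SigmaI) (auto simp: F_def)
  also have "\<dots> = N\<^sup>2 * m"
    by (simp add: F_def card_cartesian_product power2_eq_square mult.commute mult.left_commute)
  finally show ?thesis .
qed

text \<open>Each edge \<open>e\<close> of the blow-up is represented by an edge \<open>\<phi> e\<close> on the original vertices, from which it takes
  its colour: its projection if that is a triple, and otherwise an edge \<open>E v\<close> through the vertex \<open>v\<close>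
  onto which two vertices of \<open>e\<close> project, in a colour that dominates \<open>v\<close>.  The point is that two
  edges of one colour that share two vertices have representatives in the same 2-tight component.
  If \<open>e\<close> is degenerate with double vertex \<open>v\<close>, then at most one of its vertices projects elsewhere,
  so every projected triple sharing two vertices with \<open>e\<close> contains \<open>v\<close>, and all triples of the
  dominating colour through \<open>v\<close> are in the same component.  For two degenerate edges of one colour
  the components at both double vertices coincide.  Consequently every component of the blow-up lies
  above one component, apart from the few degenerate edges.\<close>

lemma M_tight_edges_blowup:
  assumes n: "3 \<le> n" and N: "3 \<le> N" and Nnm: "N \<le> n * m"
  shows "M N 2 3 2 3 \<le> M n 2 3 2 3 * m ^ 3 + N\<^sup>2 * m"
proof -
  have m: "0 < m" using N Nnm by (cases m) auto
  define p where "p x = x div m" for x :: nat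
  have p_less: "p x < n" if "x < N" for x
    using that Nnm by (simp add: p_def less_mult_imp_div_less)
  obtain c where c: "c \<in> colorings 2 (complete_hypergraph n 3)"
    and c_le: "\<And>i C. i \<in> {1..2} \<Longrightarrow> C \<in> tight_components 2 (color_class n 3 c i) \<Longrightarrow>
      card (shadow 3 C) \<le> M n 2 3 2 3"
    using M_le_iff[OF n, of 2 2 3 "M n 2 3 2 3"] by auto
  have "\<forall>v. \<exists>i. v < n \<longrightarrow> i \<in> {1..2} \<and> dominates n c i v"
    using exists_dominating_color[OF n c] by blast
  then obtain col where "\<forall>v. v < n \<longrightarrow> col v \<in> {1..2} \<and> dominates n c (col v) v"
    by (rule choice[THEN exE])
  then have col: "dominates n c (col v) v" if "v < n" for v using that by blast
  have "\<forall>v. \<exists>e. v < n \<longrightarrow> e \<in> color_class n 3 c (col v) \<and> v \<in> e"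
  proof
    fix v
    show "\<exists>e. v < n \<longrightarrow> e \<in> color_class n 3 c (col v) \<and> v \<in> e"
    proof (cases "v < n")
      case True
      then show ?thesis using dominates_edge[OF col[OF True] n True] by blast
    qed simp
  qed
  then obtain E where "\<forall>v. v < n \<longrightarrow> E v \<in> color_class n 3 c (col v) \<and> v \<in> E v"
    by (rule choice[THEN exE])
  then have E: "E v \<in> color_class n 3 c (col v)" "v \<in> E v" if "v < n" for v using that by blast+
  define double where "double e = (SOME v. \<exists>x\<in>e. \<exists>y\<in>e. x \<noteq> y \<and> p x = v \<and> p y = v)" for e
  define \<phi> where "\<phi> e = (if inj_on p e then p ` e else E (double e))" for e
  define g where "g e = (if e \<in> complete_hypergraph N 3 then c (\<phi> e) else 1)" for e
  have double: "\<exists>x\<in>e. \<exists>y\<in>e. x \<noteq> y \<and> p x = double e \<and> p y = double e" if "\<not> inj_on p e" for e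
  proof -
    have "\<exists>v. \<exists>x\<in>e. \<exists>y\<in>e. x \<noteq> y \<and> p x = v \<and> p y = v"
      using that unfolding inj_on_def by metis
    then show ?thesis unfolding double_def by (rule someI_ex)
  qed
  have double_less: "double e < n" if e: "e \<in> complete_hypergraph N 3" "\<not> inj_on p e" for e
  proof -
    obtain x where "x \<in> e" "p x = double e" using double[OF e(2)] by blast
    then show ?thesis using p_less[of x] complete_memD(3)[OF e(1)] by auto
  qed
  have double_meets: "p u = double e \<or> p w = double e"
    if e: "e \<in> complete_hypergraph N 3" "\<not> inj_on p e" and uw: "u \<in> e" "w \<in> e" "u \<noteq> w" for e u w
  proof (rule ccontr)
    assume neg: "\<not> ?thesis"
    obtain x y where xy: "x \<in> e" "y \<in> e" "x \<noteq> y" "p x = double e" "p y = double e"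
      using double[OF e(2)] by blast
    have "x \<noteq> u" "x \<noteq> w" "y \<noteq> u" "y \<noteq> w" using neg xy by auto
    then have "card {x, y, u, w} = 4" using xy uw by simp
    moreover have "card {x, y, u, w} \<le> card e"
      using xy uw complete_memD(1)[OF e(1)] by (intro card_mono) auto
    ultimately show False using complete_memD(2)[OF e(1)] by simp
  qed
  have \<phi>_degenerate: "\<phi> e \<in> color_class n 3 c (col (double e))" "double e \<in> \<phi> e"
    if "e \<in> complete_hypergraph N 3" "\<not> inj_on p e" for e
    using E[OF double_less[OF that]] that(2) by (simp_all add: \<phi>_def)
  have \<phi>_complete: "\<phi> e \<in> complete_hypergraph n 3" if e: "e \<in> complete_hypergraph N 3" for e
  proof (cases "inj_on p e")
    case True
    have "p ` e \<subseteq> {..<n}" using p_less complete_memD(3)[OF e] by auto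
    then show ?thesis
      using True complete_memD(1,2)[OF e]
      by (simp add: \<phi>_def complete_hypergraph_def nsets_def card_image)
  next
    case False
    then show ?thesis using \<phi>_degenerate(1)[OF e] color_classD(5) by blast
  qed
  have \<phi>_class: "\<phi> e \<in> color_class n 3 c i" if "e \<in> complete_hypergraph N 3" "g e = i" for e i
    using that \<phi>_complete[OF that(1)] by (simp add: color_class_def g_def)
  have col_eq: "col (double e) = i" if "e \<in> complete_hypergraph N 3" "\<not> inj_on p e" "g e = i" for e i
    using color_classD(4)[OF \<phi>_degenerate(1)[OF that(1,2)]] that by (simp add: g_def)
  let ?R = "\<lambda>i. (tight_adj 2 (color_class n 3 c i))\<^sup>*"
  have mixed: "(\<phi> e, \<phi> f) \<in> ?R i"
    if e: "e \<in> complete_hypergraph N 3" "g e = i" "\<not> inj_on p e"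
      and f: "f \<in> complete_hypergraph N 3" "g f = i" "inj_on p f"
      and uw: "u \<in> e \<inter> f" "w \<in> e \<inter> f" "u \<noteq> w" for e f i u w
  proof -
    have "p u = double e \<or> p w = double e" using double_meets[OF e(1,3)] uw by blast
    then have "double e \<in> p ` f" using uw by (metis IntD2 imageI)
    then have "double e \<in> \<phi> f" using f(3) by (simp add: \<phi>_def)
    moreover have "dominates n c i (double e)"
      using col[OF double_less[OF e(1,3)]] col_eq[OF e(1,3,2)] by simp
    ultimately show ?thesis
      using \<phi>_class[OF e(1,2)] \<phi>_class[OF f(1,2)] \<phi>_degenerate(2)[OF e(1,3)]
      unfolding dominates_def by blast
  qed
  have connected: "(\<phi> e, \<phi> f) \<in> ?R i"
    if e: "e \<in> complete_hypergraph N 3" "g e = i" and f: "f \<in> complete_hypergraph N 3" "g f = i"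
      and ef: "2 \<le> card (e \<inter> f)" for e f i
  proof -
    obtain S where "S \<subseteq> e \<inter> f" "card S = 2" using obtain_subset_with_card_n[OF ef] by metis
    then obtain u w where uw: "u \<in> e \<inter> f" "w \<in> e \<inter> f" "u \<noteq> w" by (auto simp: card_2_iff)
    consider "inj_on p e" "inj_on p f" | "\<not> inj_on p e" "inj_on p f"
      | "inj_on p e" "\<not> inj_on p f" | "\<not> inj_on p e" "\<not> inj_on p f" by blast
    then show ?thesis
    proof cases
      case 1
      have "p u \<noteq> p w" using 1(1) uw by (auto simp: inj_on_def)
      moreover have "{p u, p w} \<subseteq> \<phi> e \<inter> \<phi> f" using 1 uw by (simp add: \<phi>_def)
      ultimately show ?thesis
        by (intro r_into_rtrancl tight_adj_two_pointsI[OF \<phi>_class[OF e] \<phi>_class[OF f]])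
    next
      case 2
      then show ?thesis using mixed[OF e _ f _ uw] by blast
    next
      case 3
      then have "(\<phi> f, \<phi> e) \<in> ?R i" using mixed[OF f _ e, of u w] uw by blast
      then show ?thesis by (meson sym_tight_adj sym_rtrancl symD)
    next
      case 4
      have dom: "dominates n c i (double e)" "dominates n c i (double f)"
        using col[OF double_less[OF e(1) 4(1)]] col_eq[OF e(1) 4(1) e(2)]
          col[OF double_less[OF f(1) 4(2)]] col_eq[OF f(1) 4(2) f(2)] by simp_all
      obtain h where h: "h \<in> color_class n 3 c i" "double f \<in> h" "double e \<in> h"
        using dominates_edge[OF dom(1) n double_less[OF f(1) 4(2)]] by blast
      have "(\<phi> e, h) \<in> ?R i"
        using dom(1) \<phi>_class[OF e] h \<phi>_degenerate(2)[OF e(1) 4(1)] unfolding dominates_def by blast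
      moreover have "(h, \<phi> f) \<in> ?R i"
        using dom(2) \<phi>_class[OF f] h \<phi>_degenerate(2)[OF f(1) 4(2)] unfolding dominates_def by blast
      ultimately show ?thesis by (rule rtrancl_trans)
    qed
  qed
  show ?thesis
  proof (rule M_leI[where g = g])
    fix i D assume i: "i \<in> {1..2}" and D: "D \<in> tight_components 2 {e \<in> complete_hypergraph N 3. g e = i}"
    let ?H = "{e \<in> complete_hypergraph N 3. g e = i}"
    have lab: "?R i `` {\<phi> e} = ?R i `` {\<phi> f}" if "e \<in> ?H" "f \<in> ?H" "2 \<le> card (e \<inter> f)" for e f
      using connected[of e i f] that by (intro equiv_class_eq[OF equiv_tight]) simp
    obtain e where e: "e \<in> ?H" and D_sub: "D \<subseteq> {f \<in> ?H. ?R i `` {\<phi> f} = ?R i `` {\<phi> e}}"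
      by (rule tight_component_label[OF _ D, of "\<lambda>f. ?R i `` {\<phi> f}"])
        (simp, rule lab, assumption+)
    define C where "C = ?R i `` {\<phi> e}"
    have "\<phi> e \<in> color_class n 3 c i" using \<phi>_class e by simp
    then have C: "C \<in> tight_components 2 (color_class n 3 c i)"
      unfolding C_def by (intro tight_component_of finite_color_class)
    have C_sub: "C \<subseteq> complete_hypergraph n 3" by (rule tight_component_color_class_subset[OF C])
    have "finite C" using C_sub by (rule finite_subset) simp
    have card_C: "card C \<le> M n 2 3 2 3" using c_le[OF i C] shadow_self[OF C_sub] by simp
    let ?T = "\<lambda>k. {f \<in> complete_hypergraph N 3. (\<lambda>x. x div m) ` f = k}"
    let ?Z = "{f \<in> complete_hypergraph N 3. \<not> inj_on (\<lambda>x. x div m) f}"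
    have p_eq: "p = (\<lambda>x. x div m)" by (simp add: p_def fun_eq_iff)
    have "D \<subseteq> (\<Union>k\<in>C. ?T k) \<union> ?Z"
    proof
      fix f assume "f \<in> D"
      then have f: "f \<in> complete_hypergraph N 3" "?R i `` {\<phi> f} = C"
        using D_sub by (auto simp: C_def)
      show "f \<in> (\<Union>k\<in>C. ?T k) \<union> ?Z"
      proof (cases "inj_on p f")
        case True
        have "\<phi> f \<in> C" using f(2) by blast
        then have "p ` f \<in> C" using True by (simp add: \<phi>_def)
        then show ?thesis using f(1) unfolding p_eq by blast
      next
        case False
        then show ?thesis using f(1) unfolding p_eq by blast
      qed
    qed
    moreover have fin: "finite ((\<Union>k\<in>C. ?T k) \<union> ?Z)" using \<open>finite C\<close> by simp
    ultimately have "card D \<le> card ((\<Union>k\<in>C. ?T k) \<union> ?Z)" by (intro card_mono)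
    also have "\<dots> \<le> card (\<Union>k\<in>C. ?T k) + card ?Z" by (rule card_Un_le)
    also have "card (\<Union>k\<in>C. ?T k) \<le> (\<Sum>k\<in>C. card (?T k))" by (rule card_UN_le) (fact \<open>finite C\<close>)
    also have "(\<Sum>k\<in>C. card (?T k)) \<le> (\<Sum>k\<in>C. m ^ 3)"
      using C_sub complete_memD(2) by (intro sum_mono card_transversals_le) blast
    also have "(\<Sum>k\<in>C. m ^ 3) = card C * m ^ 3" by simp
    also have "\<dots> \<le> M n 2 3 2 3 * m ^ 3" using card_C by simp
    also have "card ?Z \<le> N\<^sup>2 * m" by (rule card_degenerate_le[OF m])
    finally have "card D \<le> M n 2 3 2 3 * m ^ 3 + N\<^sup>2 * m" by simp
    moreover have "shadow 3 D = D"
      using tight_components_subset(1)[OF _ D] by (intro shadow_self[of D N]) auto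
    ultimately show "card (shadow 3 D) \<le> M n 2 3 2 3 * m ^ 3 + N\<^sup>2 * m" by simp
  next
    fix e
    show "g e \<in> {1..2}"
    proof (cases "e \<in> complete_hypergraph N 3")
      case True
      have "c (\<phi> e) \<in> {1..2}"
        using c \<phi>_complete[OF True] unfolding colorings_def by (rule PiE_mem)
      then show ?thesis using True by (simp add: g_def)
    qed (simp add: g_def)
  qed (use N in auto)
qed

text \<open>With \<open>m\<close> about \<open>N / n\<close> the hypothesis says that \<open>f N / N\<^sup>3\<close> is eventually at most about
  \<open>h n = f n / n\<^sup>3 + 1 / n\<close>, for every \<open>n\<close>; so the sequence is eventually below each number above
  the infimum of \<open>h\<close>, and it is never far below this infimum.\<close>

lemma tendsto_of_blowup_bound:
  fixes f :: "nat \<Rightarrow> real"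
  assumes nonneg: "\<And>n. 0 \<le> f n"
    and blowup: "\<And>n N m. 3 \<le> n \<Longrightarrow> 3 \<le> N \<Longrightarrow> N \<le> n * m \<Longrightarrow>
      f N \<le> f n * real m ^ 3 + real N ^ 2 * real m"
  shows "\<exists>L. (\<lambda>n. f n / real n ^ 3) \<longlonglongrightarrow> L"
proof -
  define h where "h n = f n / real n ^ 3 + 1 / real n" for n
  define r where "r n N = f n * (1 / real n + 1 / real N) ^ 3 + (1 / real n + 1 / real N)" for n N
  have bound: "f N / real N ^ 3 \<le> r n N" if "3 \<le> n" "3 \<le> N" for n N
  proof -
    define m where "m = N div n + 1"
    have "N = n * (N div n) + N mod n" by simp
    moreover have "N mod n < n" using that by simp
    ultimately have "N \<le> n * (N div n) + n" by linarith
    then have "N \<le> n * m" by (simp add: m_def)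
    then have "f N \<le> f n * real m ^ 3 + real N ^ 2 * real m" using blowup that by blast
    then have "f N / real N ^ 3 \<le> (f n * real m ^ 3 + real N ^ 2 * real m) / real N ^ 3"
      by (rule divide_right_mono) simp
    also have "\<dots> = f n * (real m / real N) ^ 3 + real m / real N"
      using that by (simp add: field_simps power2_eq_square power3_eq_cube)
    also have "\<dots> \<le> r n N"
    proof -
      have "real (N div n) \<le> real N / real n" by (rule of_nat_div_le_of_nat)
      then have "real m / real N \<le> (real N / real n + 1) / real N"
        by (intro divide_right_mono) (auto simp: m_def)
      also have "\<dots> = 1 / real n + 1 / real N" using that by (simp add: field_simps)
      finally have "real m / real N \<le> 1 / real n + 1 / real N" .
      then show ?thesis
        unfolding r_def using nonneg by (intro add_mono mult_left_mono power_mono) auto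
    qed
    finally show ?thesis .
  qed
  have r_lim: "(\<lambda>N. r n N) \<longlonglongrightarrow> h n" for n
  proof -
    have "(\<lambda>N. r n N) \<longlonglongrightarrow> f n * (1 / real n + 0) ^ 3 + (1 / real n + 0)"
      unfolding r_def by (intro tendsto_intros lim_1_over_n)
    then show ?thesis by (simp add: h_def power_divide)
  qed
  have bdd: "bdd_below (h ` {3..})"
    using nonneg by (intro bdd_belowI[of _ 0]) (auto simp: h_def)
  define L where "L = Inf (h ` {3..})"
  have "(\<lambda>n. f n / real n ^ 3) \<longlonglongrightarrow> L"
  proof (rule order_tendstoI)
    fix a assume "a < L"
    have "(\<lambda>n. L - 1 / real n) \<longlonglongrightarrow> L - 0" by (intro tendsto_intros lim_1_over_n)
    then have "\<forall>\<^sub>F n in sequentially. a < L - 1 / real n"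
      using \<open>a < L\<close> by (intro order_tendstoD(1)) auto
    then show "\<forall>\<^sub>F n in sequentially. a < f n / real n ^ 3"
      using eventually_ge_at_top[of 3]
    proof eventually_elim
      case (elim n)
      have "L \<le> h n" unfolding L_def using elim(2) bdd by (intro cInf_lower) auto
      then show ?case using elim(1) by (simp add: h_def)
    qed
  next
    fix a assume "L < a"
    then have "\<exists>y\<in>h ` {3..}. y < a" unfolding L_def using bdd by (subst (asm) cInf_less_iff) auto
    then obtain n where n: "3 \<le> n" "h n < a" by auto
    have "\<forall>\<^sub>F N in sequentially. r n N < a" using order_tendstoD(2)[OF r_lim n(2)] .
    then show "\<forall>\<^sub>F N in sequentially. f N / real N ^ 3 < a"
      using eventually_ge_at_top[of 3]
    proof eventually_elim
      case (elim N)
      then show ?case using bound[OF n(1) elim(2)] by linarith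
    qed
  qed
  then show ?thesis by blast
qed

lemma choose_three_asymptotics: "(\<lambda>n. real (n choose 3) / real n ^ 3) \<longlonglongrightarrow> 1 / 6"
proof -
  have "(\<lambda>n. (1 - 1 / real n) * (1 - 2 * (1 / real n)) / 6) \<longlonglongrightarrow> (1 - 0) * (1 - 2 * 0) / 6"
    by (intro tendsto_intros lim_1_over_n) auto
  moreover have "\<forall>\<^sub>F n in sequentially.
      (1 - 1 / real n) * (1 - 2 * (1 / real n)) / 6 = real (n choose 3) / real n ^ 3"
    using eventually_ge_at_top[of 1]
  proof eventually_elim
    case (elim n)
    then show ?case by (simp add: real_choose_three power3_eq_cube field_simps)
  qed
  ultimately show ?thesis using Lim_transform_eventually by fastforce
qed

lemma M_tight_edges_convergent:
  "\<exists>L. (\<lambda>n. real (M n 2 3 2 3) / real (n choose 3)) \<longlonglongrightarrow> L"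
proof -
  have "\<exists>L. (\<lambda>n. real (M n 2 3 2 3) / real n ^ 3) \<longlonglongrightarrow> L"
  proof (rule tendsto_of_blowup_bound)
    fix n N m :: nat assume "3 \<le> n" "3 \<le> N" "N \<le> n * m"
    then have "real (M N 2 3 2 3) \<le> real (M n 2 3 2 3 * m ^ 3 + N\<^sup>2 * m)"
      using M_tight_edges_blowup of_nat_le_iff by blast
    then show "real (M N 2 3 2 3) \<le> real (M n 2 3 2 3) * real m ^ 3 + (real N)\<^sup>2 * real m" by simp
  qed simp
  then obtain L where "(\<lambda>n. real (M n 2 3 2 3) / real n ^ 3) \<longlonglongrightarrow> L" by blast
  then have "(\<lambda>n. (real (M n 2 3 2 3) / real n ^ 3) / (real (n choose 3) / real n ^ 3)) \<longlonglongrightarrow> L / (1 / 6)"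
    by (rule tendsto_divide) (use choose_three_asymptotics in auto)
  moreover have "\<forall>\<^sub>F n in sequentially. (real (M n 2 3 2 3) / real n ^ 3) / (real (n choose 3) / real n ^ 3)
      = real (M n 2 3 2 3) / real (n choose 3)"
    using eventually_ge_at_top[of 1] by eventually_elim simp
  ultimately have "(\<lambda>n. real (M n 2 3 2 3) / real (n choose 3)) \<longlonglongrightarrow> L / (1 / 6)"
    by (rule Lim_transform_eventually)
  then show ?thesis ..
qed

section \<open>Upper bound for tight components\<close>

lemma card_edges_with_part_le:
  assumes "n = card A + card B" "A \<union> B = {..<n}" "A \<inter> B = {}"
  shows "card {f \<in> complete_hypergraph n k. card (f \<inter> A) = j}
    \<le> (card A choose j) * (card B choose (k - j))"
proof -
  let ?X = "{f \<in> complete_hypergraph n k. card (f \<inter> A) = j}"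
  let ?h = "\<lambda>f. (f \<inter> A, f \<inter> B)"
  have fin: "finite A" "finite B"
    using finite_Un[of A B] unfolding assms(2) by simp_all
  have split: "f = (f \<inter> A) \<union> (f \<inter> B)" if "f \<in> ?X" for f
    using that complete_memD(3)[of f n k] assms(2) by blast
  have "inj_on ?h ?X"
  proof (rule inj_onI)
    fix f g assume "f \<in> ?X" "g \<in> ?X" "?h f = ?h g"
    then show "f = g" using split[of f] split[of g] by simp
  qed
  moreover have "?h ` ?X \<subseteq> nsets A j \<times> nsets B (k - j)"
  proof
    fix q assume "q \<in> ?h ` ?X"
    then obtain f where f: "f \<in> ?X" "q = (f \<inter> A, f \<inter> B)" by blast
    have ff: "finite f" "card f = k" using f(1) complete_memD by blast+
    have "(f \<inter> A) \<inter> (f \<inter> B) = {}" using assms(3) by blast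
    then have "card (f \<inter> A) + card (f \<inter> B) = k"
      using card_Un_disjoint[of "f \<inter> A" "f \<inter> B"] split[OF f(1)] ff by simp
    then have "card (f \<inter> B) = k - j" using f(1) by simp
    then show "q \<in> nsets A j \<times> nsets B (k - j)"
      using f ff by (auto simp: nsets_def)
  qed
  ultimately have "card ?X \<le> card (nsets A j \<times> nsets B (k - j))"
    using fin by (intro card_inj_on_le) (auto simp: finite_imp_finite_nsets)
  then show ?thesis by (simp add: card_cartesian_product)
qed

text \<open>The colour of a triple is the parity of its intersection with one half \<open>A\<close>.  Two triples that
  share two vertices have intersections with \<open>A\<close> whose sizes differ by at most one, so equal colours
  force equal sizes and components are confined to one size.\<close>

lemma M_tight_edges_le:
  assumes m: "2 \<le> m"
  shows "M (2 * m) 2 3 2 3 \<le> m * (m choose 2)"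
proof -
  define A where "A = {..<m}"
  define B where "B = {m..<2 * m}"
  define g where "g e = 1 + card (e \<inter> A) mod 2" for e
  have AB: "2 * m = card A + card B" "A \<union> B = {..<2 * m}" "A \<inter> B = {}" "card A = m" "card B = m"
    by (auto simp: A_def B_def)
  have close: "card (e \<inter> A) = card (e \<inter> f \<inter> A) \<or> card (e \<inter> A) = card (e \<inter> f \<inter> A) + 1"
    if e: "e \<in> complete_hypergraph (2 * m) 3" and ef: "2 \<le> card (e \<inter> f)" for e f
  proof -
    have fin: "finite e" using complete_memD(1)[OF e] .
    have "card (e - f) = card e - card (e \<inter> f)" using fin by (simp add: card_Diff_subset_Int)
    then have "card (e - f) \<le> 1" using ef complete_memD(2)[OF e] by simp
    moreover have "card ((e - f) \<inter> A) \<le> card (e - f)" using fin by (intro card_mono) auto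
    moreover have "card (e \<inter> A) = card ((e \<inter> f \<inter> A) \<union> ((e - f) \<inter> A))"
      by (rule arg_cong[where f = card]) blast
    moreover have "\<dots> = card (e \<inter> f \<inter> A) + card ((e - f) \<inter> A)"
      using fin by (intro card_Un_disjoint) auto
    ultimately show ?thesis by linarith
  qed
  have small: "m choose 3 \<le> m * (m choose 2)"
  proof -
    have "real m * (real m - 1) * (real m - 2) / 6 \<le> real m * (real m - 1) * (3 * real m) / 6"
      using m by (intro divide_right_mono mult_left_mono) auto
    also have "\<dots> = real (m * (m choose 2))" by (simp add: real_choose_two)
    finally show ?thesis unfolding real_choose_three[symmetric] of_nat_le_iff .
  qed
  show ?thesis
  proof (rule M_leI[where g = g])
    fix i C assume C: "C \<in> tight_components 2 {e \<in> complete_hypergraph (2 * m) 3. g e = i}"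
    let ?H = "{e \<in> complete_hypergraph (2 * m) 3. g e = i}"
    have lab: "card (e \<inter> A) = card (f \<inter> A)"
      if ef: "e \<in> ?H" "f \<in> ?H" "2 \<le> card (e \<inter> f)" for e f
    proof -
      have parity: "x = y"
        if "x = k \<or> x = k + 1" "y = k \<or> y = k + 1" "x mod 2 = y mod 2" for x y k :: nat
        using that by presburger
      have "e \<in> complete_hypergraph (2 * m) 3" "f \<in> complete_hypergraph (2 * m) 3"
        "2 \<le> card (f \<inter> e)" "card (e \<inter> A) mod 2 = card (f \<inter> A) mod 2"
        using ef by (simp_all add: g_def Int_commute)
      then show ?thesis
        using parity[OF close[of e f] close[of f e, unfolded Int_commute[of f e]]] ef(3)
        by (simp add: Int_commute)
    qed
    obtain e where e: "e \<in> ?H" "C \<subseteq> {f \<in> ?H. card (f \<inter> A) = card (e \<inter> A)}"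
      by (rule tight_component_label[OF _ C, of "\<lambda>e. card (e \<inter> A)"])
        (simp, rule lab, assumption+)
    define j where "j = card (e \<inter> A)"
    have "C \<subseteq> {f \<in> complete_hypergraph (2 * m) 3. card (f \<inter> A) = j}"
      using e(2) by (auto simp: j_def)
    then have "card C \<le> card {f \<in> complete_hypergraph (2 * m) 3. card (f \<inter> A) = j}"
      by (intro card_mono) auto
    also have "\<dots> \<le> (m choose j) * (m choose (3 - j))"
      using card_edges_with_part_le[OF AB(1-3), of 3 j] AB(4,5) by simp
    also have "\<dots> \<le> m * (m choose 2)"
    proof -
      have e': "finite e" "card e = 3" using e(1) complete_memD by blast+
      then have "card (e \<inter> A) \<le> card e" by (intro card_mono) auto
      then have "j \<le> 3" using e'(2) by (simp add: j_def)
      then consider "j = 0" | "j = 1" | "j = 2" | "j = 3" by linarith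
      then show ?thesis using small by cases (simp_all add: mult.commute)
    qed
    finally have "card C \<le> m * (m choose 2)" .
    moreover have "shadow 3 C = C"
      using tight_components_subset(1)[OF _ C] by (intro shadow_self[of C "2 * m"]) auto
    ultimately show "card (shadow 3 C) \<le> m * (m choose 2)" by simp
  qed (use m in \<open>auto simp: g_def\<close>)
qed

text \<open>It suffices to look at even \<open>n\<close>, as the limit is known to exist.\<close>

lemma M_tight_edges_limit_le:
  assumes "(\<lambda>n. real (M n 2 3 2 3) / real (n choose 3)) \<longlonglongrightarrow> L"
  shows "L \<le> 3 / 8"
proof (rule LIMSEQ_le)
  show "(\<lambda>m. real (M (2 * m) 2 3 2 3) / real (2 * m choose 3)) \<longlonglongrightarrow> L"
    using LIMSEQ_subseq_LIMSEQ[OF assms, of "\<lambda>m. 2 * m"] by (simp add: strict_mono_def comp_def)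
  have "(\<lambda>m. 3 / (4 * (2 - 1 / real m))) \<longlonglongrightarrow> 3 / (4 * (2 - 0))"
    by (intro tendsto_intros lim_1_over_n) auto
  then show "(\<lambda>m. 3 / (4 * (2 - 1 / real m))) \<longlonglongrightarrow> 3 / 8" by simp
  have "real (M (2 * m) 2 3 2 3) / real (2 * m choose 3) \<le> 3 / (4 * (2 - 1 / real m))"
    if m: "2 \<le> m" for m
  proof -
    have "real (M (2 * m) 2 3 2 3) \<le> real (m * (m choose 2))"
      using M_tight_edges_le[OF m] of_nat_le_iff by blast
    also have "\<dots> = 3 / (4 * (2 - 1 / real m)) * real (2 * m choose 3)"
      using m by (simp add: real_choose_two real_choose_three field_simps)
    finally show ?thesis using m by (simp add: pos_divide_le_eq)
  qed
  then show "\<exists>N. \<forall>m\<ge>N. real (M (2 * m) 2 3 2 3) / real (2 * m choose 3) \<le> 3 / (4 * (2 - 1 / real m))"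
    by blast
qed

section \<open>Lower bound for tight components\<close>

lemma sum_degrees:
  assumes "C \<subseteq> nsets {..<n::nat} k"
  shows "(\<Sum>z<n. card {e \<in> C. z \<in> e}) = k * card C"
proof (rule sum_multicount)
  show "finite C" using assms by (rule finite_subset) (simp add: finite_imp_finite_nsets)
  show "\<forall>e\<in>C. card {z \<in> {..<n}. z \<in> e} = k"
  proof
    fix e assume "e \<in> C"
    then have "e \<in> nsets {..<n} k" using assms by blast
    then have "{z \<in> {..<n}. z \<in> e} = e" "card e = k" by (auto simp: nsets_def)
    then show "card {z \<in> {..<n}. z \<in> e} = k" by simp
  qed
qed simp

text \<open>A form of the Kruskal-Katona theorem for triples with the optimal constant.  The edges at a
  vertex \<open>z\<close> correspond to pairs that lie both in the shadow \<open>G\<close> and inside the neighbourhood of \<open>z\<close>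
  in \<open>G\<close>, so their number is at most the geometric mean of \<open>card G\<close> and \<open>d\<^sup>2 / 2\<close>, where \<open>d\<close> is the
  degree of \<open>z\<close> in \<open>G\<close>.  This is linear in \<open>d\<close> and can be summed over \<open>z\<close>.\<close>

lemma card_le_card_shadow:
  assumes C: "C \<subseteq> complete_hypergraph n 3"
  shows "9 * real (card C) ^ 2 \<le> 2 * real (card (shadow 2 C)) ^ 3"
proof -
  define G where "G = shadow 2 C"
  define g where "g = real (card G)"
  have G_sub: "G \<subseteq> nsets {..<n} 2" unfolding G_def by (rule shadow_subset_nsets[OF C])
  have finG: "finite G" unfolding G_def by (rule finite_shadow[OF C])
  have C_sub: "C \<subseteq> nsets {..<n} 3" using C by (simp add: complete_hypergraph_def)
  have finC: "finite C" using C by (rule finite_subset) simp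
  have pair: "p \<in> G" if "e \<in> C" "p \<subseteq> e" "card p = 2" for e p
    using that by (auto simp: G_def shadow_def)
  have minus: "card (e - {z}) = 2" "finite e" if "e \<in> C" "z \<in> e" for e z
    using that C complete_memD[of e n 3] by (auto simp: card_Diff_singleton)
  have deg: "real (card {e \<in> C. z \<in> e}) \<le> real (card {p \<in> G. z \<in> p}) * sqrt (g / 2)" for z
  proof -
    define D where "D = {e \<in> C. z \<in> e}"
    define N where "N = {x. x \<noteq> z \<and> {z, x} \<in> G}"
    define d where "d = card {p \<in> G. z \<in> p}"
    have inj: "inj_on (\<lambda>e. e - {z}) D" unfolding D_def inj_on_def by blast
    have "(\<lambda>e. e - {z}) ` D \<subseteq> G" unfolding D_def using minus(1) pair by blast
    then have 1: "card D \<le> card G" using inj finG by (intro card_inj_on_le)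
    have inj': "inj_on (\<lambda>x. {z, x}) N" unfolding N_def inj_on_def by (auto simp: doubleton_eq_iff)
    have img: "(\<lambda>x. {z, x}) ` N \<subseteq> {p \<in> G. z \<in> p}" unfolding N_def by blast
    have finN: "finite N" using inj_on_finite[OF inj' img] finG by simp
    have N_le: "card N \<le> d" unfolding d_def using inj' img finG by (intro card_inj_on_le) auto
    have "(\<lambda>e. e - {z}) ` D \<subseteq> nsets N 2"
    proof
      fix p assume "p \<in> (\<lambda>e. e - {z}) ` D"
      then obtain e where e: "e \<in> C" "z \<in> e" "p = e - {z}" by (auto simp: D_def)
      have "x \<in> N" if "x \<in> p" for x
      proof -
        have "x \<noteq> z" "{z, x} \<subseteq> e" using that e by auto
        then show ?thesis using pair[OF e(1), of "{z, x}"] by (simp add: N_def)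
      qed
      then show "p \<in> nsets N 2" using minus[OF e(1,2)] e(3) by (auto simp: nsets_def)
    qed
    then have "card D \<le> card (nsets N 2)"
      using inj finN by (intro card_inj_on_le[of "\<lambda>e. e - {z}"]) (auto simp: finite_imp_finite_nsets)
    also have "\<dots> = card N choose 2" by simp
    also have "\<dots> \<le> d choose 2" using N_le by (rule binomial_right_mono)
    finally have "real (card D) \<le> real (d choose 2)" by simp
    also have "\<dots> \<le> real d ^ 2 / 2"
      unfolding real_choose_two power2_eq_square by (intro divide_right_mono mult_left_mono) auto
    finally have 2: "real (card D) \<le> real d ^ 2 / 2" .
    have "real (card D) ^ 2 \<le> g * (real d ^ 2 / 2)"
      unfolding power2_eq_square[of "real (card D)"] using 1 2 by (intro mult_mono) (auto simp: g_def)
    also have "\<dots> = (real d * sqrt (g / 2)) ^ 2"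
      by (simp add: power_mult_distrib g_def)
    finally have "real (card D) \<le> real d * sqrt (g / 2)"
      by (rule power2_le_imp_le) (simp add: g_def)
    then show ?thesis by (simp add: D_def d_def)
  qed
  have "3 * real (card C) = (\<Sum>z<n. real (card {e \<in> C. z \<in> e}))"
    using arg_cong[where f = real, OF sum_degrees[OF C_sub]] by simp
  also have "\<dots> \<le> (\<Sum>z<n. real (card {p \<in> G. z \<in> p}) * sqrt (g / 2))"
    by (rule sum_mono) (rule deg)
  also have "\<dots> = (\<Sum>z<n. real (card {p \<in> G. z \<in> p})) * sqrt (g / 2)"
    by (simp only: sum_distrib_right)
  also have "(\<Sum>z<n. real (card {p \<in> G. z \<in> p})) = 2 * g"
    using arg_cong[where f = real, OF sum_degrees[OF G_sub]] by (simp add: g_def)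
  finally have "(3 * real (card C)) ^ 2 \<le> (2 * g * sqrt (g / 2)) ^ 2"
    by (rule power_mono) simp
  also have "\<dots> = 2 * g ^ 3"
    by (simp add: power_mult_distrib g_def power2_eq_square power3_eq_cube)
  finally show ?thesis by (simp add: power_mult_distrib g_def G_def)
qed

text \<open>If the components of a colour are small, this makes their number of edges linear in the number of
  shadow pairs, of which the whole colour has only \<open>n choose 2\<close>.\<close>

lemma card_le_of_small_component:
  assumes C: "C \<subseteq> complete_hypergraph n 3" and x: "0 \<le> x" "real (card C) \<le> 9 / 2 * x ^ 3"
  shows "real (card C) \<le> x * real (card (shadow 2 C))"
proof -
  have "9 * real (card C) ^ 3 = 9 * real (card C) ^ 2 * real (card C)"
    by (simp add: power2_eq_square power3_eq_cube)
  also have "\<dots> \<le> (2 * real (card (shadow 2 C)) ^ 3) * (9 / 2 * x ^ 3)"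
    by (rule mult_mono[OF card_le_card_shadow[OF C] x(2)]) simp_all
  also have "\<dots> = 9 * (x * real (card (shadow 2 C))) ^ 3" by (simp add: power_mult_distrib)
  finally have "real (card C) ^ 3 \<le> (x * real (card (shadow 2 C))) ^ 3" by simp
  then show ?thesis using x(1) by (subst (asm) power_mono_iff) simp_all
qed

lemma sum_shadows_tight_components_le:
  "(\<Sum>C\<in>tight_components s (color_class n k c i). card (shadow s C)) \<le> n choose s"
proof -
  let ?T = "tight_components s (color_class n k c i)"
  have sub: "shadow s C \<subseteq> nsets {..<n} s" "finite (shadow s C)" if "C \<in> ?T" for C
    using shadow_subset_nsets finite_shadow tight_component_color_class_subset[OF that] by blast+
  have "shadow s C \<inter> shadow s D = {}" if CD: "C \<in> ?T" "D \<in> ?T" "C \<noteq> D" for C D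
  proof (rule ccontr)
    assume "\<not> ?thesis"
    then obtain S e f where S: "card S = s" "e \<in> C" "S \<subseteq> e" "f \<in> D" "S \<subseteq> f"
      by (auto simp: shadow_def)
    have "finite e"
      using S(2) tight_component_color_class_subset[OF CD(1)] complete_memD(1) by blast
    then have "card S \<le> card (e \<inter> f)" using S(3,5) by (intro card_mono) auto
    then show False
      using tight_components_eqI[OF finite_color_class CD(1,2) S(2,4)] CD(3) S(1) by simp
  qed
  then have "(\<Sum>C\<in>?T. card (shadow s C)) = card (\<Union>C\<in>?T. shadow s C)"
    using sub(2) by (intro card_UN_disjoint[symmetric]) (auto simp: finite_tight_components)
  also have "\<dots> \<le> card (nsets {..<n} s)"
    using sub(1) by (intro card_mono) (auto simp: finite_imp_finite_nsets)
  finally show ?thesis by simp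
qed

text \<open>Suppose that no component reaches the bound.  The component of colour \<open>i\<close> at \<open>A\<close> contains all
  triples of that colour that meet \<open>A\<close>, so colour \<open>i\<close> has at most a fraction \<open>6/25 + 1/64\<close> of all
  triples.  The other colour then has a fraction of at least \<open>74/100\<close>, whereas its components are so small
  that together their edges are only about a fraction \<open>63/100\<close>.\<close>

lemma no_small_tight_components_if_dominated:
  assumes n: "14 \<le> n" and c: "c \<in> colorings 2 (complete_hypergraph n 3)" and i: "i \<in> {1..2}"
    and A: "A \<subseteq> {..<n}" "\<And>v. v \<in> A \<Longrightarrow> dominates n c i v" "real (card ({..<n} - A)) \<le> real n / 4"
    and small: "\<And>j C. j \<in> {1..2} \<Longrightarrow> C \<in> tight_components 2 (color_class n 3 c j) \<Longrightarrow>
      real (card C) < 6 / 25 * real (n choose 3)"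
  shows False
proof -
  define N where "N = real (n choose 3)"
  have n3: "3 \<le> n" using n by simp
  have "A \<noteq> {}" using A(3) n by auto
  then obtain v where v: "v \<in> A" by blast
  then have "v < n" using A(1) by auto
  obtain C where C: "C \<in> tight_components 2 (color_class n 3 c i)"
    and max: "\<And>e w. e \<in> color_class n 3 c i \<Longrightarrow> w \<in> e \<Longrightarrow> dominates n c i w \<Longrightarrow> e \<in> C"
    using dominating_component[OF A(2)[OF v] \<open>v < n\<close> n3] by metis
  let ?H = "color_class n 3 c i" and ?J = "color_class n 3 c (3 - i)"
  let ?T = "tight_components 2 ?J"
  let ?B = "{..<n} - A"
  have j: "3 - i \<in> {1..2}" using i by auto
  have "?H \<subseteq> C \<union> nsets ?B 3"
  proof
    fix e assume e: "e \<in> ?H"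
    show "e \<in> C \<union> nsets ?B 3"
    proof (cases "e \<inter> A = {}")
      case True
      then show ?thesis using color_classD(1-3)[OF e] by (auto simp: nsets_def)
    next
      case False
      then show ?thesis using max[OF e] A(2) by blast
    qed
  qed
  moreover have "finite C"
    using tight_component_color_class_subset[OF C] by (rule finite_subset) simp
  ultimately have "card ?H \<le> card (C \<union> nsets ?B 3)"
    by (intro card_mono) (simp_all add: finite_imp_finite_nsets)
  also have "\<dots> \<le> card C + card (nsets ?B 3)" by (rule card_Un_le)
  finally have "real (card ?H) \<le> real (card C) + real (card ?B choose 3)"
    by (simp flip: of_nat_add)
  moreover have "real (card ?B choose 3) \<le> (1 / 4) ^ 3 * N"
  proof -
    have "card ?B \<le> n" using card_mono[of "{..<n}" ?B] by simp
    then have "real (card ?B choose 3) \<le> (real (card ?B) / real n) ^ 3 * N"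
      unfolding N_def by (rule choose_three_le)
    also have "\<dots> \<le> (1 / 4) ^ 3 * N"
      using A(3) n by (intro mult_right_mono power_mono) (auto simp: N_def field_simps)
    finally show ?thesis .
  qed
  moreover have "real (card ?H) + real (card ?J) = N"
    using card_color_classes[OF c i] unfolding N_def by (metis of_nat_add)
  moreover have "0 \<le> N" by (simp add: N_def)
  ultimately have J: "74 / 100 * N \<le> real (card ?J)"
    using small[OF i C] unfolding N_def[symmetric] by (simp add: power3_eq_cube)
  have N_le: "N \<le> real n ^ 3 / 6"
    unfolding N_def real_choose_three power3_eq_cube using n
    by (intro divide_right_mono mult_mono) auto
  \<comment> \<open>The factor \<open>21/100\<close> is the cube root of \<open>(2/9) * (6/25) * (1/6)\<close>, rounded up.\<close>
  have each: "real (card D) \<le> 21 / 100 * real n * real (card (shadow 2 D))" if D: "D \<in> ?T" for D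
  proof (rule card_le_of_small_component)
    show "D \<subseteq> complete_hypergraph n 3" by (rule tight_component_color_class_subset[OF D])
    have "real (card D) \<le> 6 / 25 * (real n ^ 3 / 6)"
      using small[OF j D] N_le unfolding N_def by linarith
    also have "\<dots> \<le> 9 / 2 * (21 / 100 * real n) ^ 3"
      by (simp add: power_mult_distrib power3_eq_cube)
    finally show "real (card D) \<le> 9 / 2 * (21 / 100 * real n) ^ 3" .
  qed simp
  have "real (card ?J) = (\<Sum>D\<in>?T. real (card D))"
    using card_eq_sum_tight_components[of ?J 2] by simp
  also have "\<dots> \<le> (\<Sum>D\<in>?T. 21 / 100 * real n * real (card (shadow 2 D)))"
    by (rule sum_mono) (rule each)
  also have "\<dots> = 21 / 100 * real n * real (\<Sum>D\<in>?T. card (shadow 2 D))"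
    by (simp only: sum_distrib_left of_nat_sum)
  also have "\<dots> \<le> 21 / 100 * real n * real (n choose 2)"
    using sum_shadows_tight_components_le[of 2 n 3 c "3 - i"]
    by (intro mult_left_mono of_nat_mono) simp_all
  finally have "74 / 100 * N \<le> 21 / 100 * real n * real (n choose 2)" using J by linarith
  then have "(real n * (real n - 1)) * (74 * (real n - 2)) \<le> (real n * (real n - 1)) * (63 * real n)"
    unfolding N_def real_choose_two real_choose_three by (simp add: field_simps)
  then have "74 * (real n - 2) \<le> 63 * real n"
    using n by (subst (asm) mult_le_cancel_left_pos) auto
  then show False using n by simp
qed

text \<open>In the remaining case each colour dominates more than a quarter of the vertices.  A triple that
  meets both \<open>A\<close> and \<open>B\<close> lies, whatever its colour, in the component of that colour at the set it
  dominates, so two components contain all of the crossing triples, a fraction of more than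
  \<open>9/16 > 2 * 6/25\<close>.\<close>

lemma tight_component_ge:
  assumes n: "14 \<le> n" and c: "c \<in> colorings 2 (complete_hypergraph n 3)"
  shows "\<exists>i\<in>{1..2}. \<exists>C\<in>tight_components 2 (color_class n 3 c i).
    6 / 25 * real (n choose 3) \<le> real (card C)"
proof (rule ccontr)
  assume neg: "\<not> ?thesis"
  have small: "real (card C) < 6 / 25 * real (n choose 3)"
    if "j \<in> {1..2}" "C \<in> tight_components 2 (color_class n 3 c j)" for j C
    using neg that by (meson not_le)
  define A where "A = {v \<in> {..<n}. dominates n c 1 v}"
  define B where "B = {..<n} - A"
  have n3: "3 \<le> n" using n by simp
  have A_dom: "dominates n c 1 v" if "v \<in> A" for v using that by (simp add: A_def)
  have B_dom: "dominates n c 2 v" if "v \<in> B" for v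
  proof -
    have v: "v < n" "\<not> dominates n c 1 v" using that by (auto simp: A_def B_def)
    obtain i where "i \<in> {1..2}" "dominates n c i v" using exists_dominating_color[OF n3 c v(1)] by blast
    then show ?thesis using v(2) by (cases "i = 1") (auto simp: le_Suc_eq numeral_2_eq_2)
  qed
  have AB: "A \<subseteq> {..<n}" "B \<subseteq> {..<n}" "{..<n} - A = B" "{..<n} - B = A" "finite A" "finite B"
    by (auto simp: A_def B_def)
  have "card A + card B = n"
    using card_Un_disjoint[of A B] AB(5,6) AB(1) unfolding B_def by (simp add: Un_absorb1)
  then have card_AB: "n = card A + card B" by simp
  have A_big: "real n / 4 < real (card A)"
  proof (rule ccontr)
    assume "\<not> ?thesis"
    then have "real (card ({..<n} - B)) \<le> real n / 4" using AB(4) by simp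
    then show False
      using no_small_tight_components_if_dominated[OF n c _ AB(2) B_dom _ small] by simp
  qed
  have B_big: "real n / 4 < real (card B)"
  proof (rule ccontr)
    assume "\<not> ?thesis"
    then have "real (card ({..<n} - A)) \<le> real n / 4" using AB(3) by simp
    then show False
      using no_small_tight_components_if_dominated[OF n c _ AB(1) A_dom _ small] by simp
  qed
  have "A \<noteq> {}" "B \<noteq> {}" using A_big B_big by auto
  then obtain v w where v: "v \<in> A" "v < n" and w: "w \<in> B" "w < n" using AB(1,2) by blast
  obtain C where C: "C \<in> tight_components 2 (color_class n 3 c 1)"
    and C_max: "\<And>e w. e \<in> color_class n 3 c 1 \<Longrightarrow> w \<in> e \<Longrightarrow> dominates n c 1 w \<Longrightarrow> e \<in> C"
    using dominating_component[OF A_dom[OF v(1)] v(2) n3] by metis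
  obtain D where D: "D \<in> tight_components 2 (color_class n 3 c 2)"
    and D_max: "\<And>e w. e \<in> color_class n 3 c 2 \<Longrightarrow> w \<in> e \<Longrightarrow> dominates n c 2 w \<Longrightarrow> e \<in> D"
    using dominating_component[OF B_dom[OF w(1)] w(2) n3] by metis
  have "complete_hypergraph n 3 \<subseteq> (C \<union> D) \<union> (nsets A 3 \<union> nsets B 3)"
  proof
    fix e assume e: "e \<in> complete_hypergraph n 3"
    note e' = complete_memD[OF e]
    show "e \<in> (C \<union> D) \<union> (nsets A 3 \<union> nsets B 3)"
    proof (cases "e \<inter> A = {} \<or> e \<inter> B = {}")
      case True
      then have "e \<subseteq> B \<or> e \<subseteq> A" using e'(3) by (auto simp: B_def)
      then show ?thesis using e'(1,2) by (auto simp: nsets_def)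
    next
      case False
      then obtain x y where xy: "x \<in> e" "x \<in> A" "y \<in> e" "y \<in> B" by blast
      have "c e \<in> {1..2}" using c e unfolding colorings_def by (rule PiE_mem)
      then have "c e = 1 \<or> c e = 2" by auto
      then have "e \<in> color_class n 3 c 1 \<or> e \<in> color_class n 3 c 2"
        using e by (simp add: color_class_def)
      then show ?thesis
        using C_max[OF _ xy(1) A_dom[OF xy(2)]] D_max[OF _ xy(3) B_dom[OF xy(4)]] by blast
    qed
  qed
  moreover have "finite C" "finite D"
    using tight_component_color_class_subset[OF C] tight_component_color_class_subset[OF D]
    by (auto intro: finite_subset[OF _ finite_complete])
  ultimately have "n choose 3 \<le> card ((C \<union> D) \<union> (nsets A 3 \<union> nsets B 3))"
    unfolding card_complete[symmetric] using AB(5,6)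
    by (intro card_mono) (simp_all add: finite_imp_finite_nsets)
  also have "\<dots> \<le> card (C \<union> D) + card (nsets A 3 \<union> nsets B 3)" by (rule card_Un_le)
  also have "card (C \<union> D) \<le> card C + card D" by (rule card_Un_le)
  also have "card (nsets A 3 \<union> nsets B 3) \<le> card (nsets A 3) + card (nsets B 3)" by (rule card_Un_le)
  finally have "real (n choose 3) \<le>
      real (card C + card D + ((card A choose 3) + (card B choose 3)))" by simp
  then have "real (n choose 3) - real (card A choose 3) - real (card B choose 3)
      \<le> real (card C) + real (card D)" by simp
  moreover have "real (card C) < 6 / 25 * real (n choose 3)" "real (card D) < 6 / 25 * real (n choose 3)"
    using small[OF _ C] small[OF _ D] by simp_all
  ultimately have upper: "real (card A) * real (card B) * (real n - 2) / 2 < 12 / 25 * real (n choose 3)"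
    using choose_three_split[OF card_AB] by linarith
  have "0 \<le> (real (card A) - real n / 4) * (real (card B) - real n / 4)"
    using A_big B_big by (intro mult_nonneg_nonneg) auto
  also have "\<dots> = real (card A) * real (card B) - real n / 4 * (real (card A) + real (card B))
      + real n ^ 2 / 16"
    by (simp add: power2_eq_square algebra_simps)
  also have "real (card A) + real (card B) = real n" unfolding card_AB by simp
  finally have "3 / 16 * real n ^ 2 \<le> real (card A) * real (card B)"
    by (simp add: power2_eq_square)
  then have "3 / 16 * real n ^ 2 * (real n - 2) / 2 \<le> real (card A) * real (card B) * (real n - 2) / 2"
    using n by (intro divide_right_mono mult_right_mono) auto
  moreover have "12 / 25 * real (n choose 3) \<le> 3 / 16 * real n ^ 2 * (real n - 2) / 2"
  proof -
    have "real n * (real n - 1) * (real n - 2) / 6 \<le> real n * real n * (real n - 2) / 6"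
      using n by (intro divide_right_mono mult_right_mono mult_left_mono) auto
    moreover have "0 \<le> real n * real n * (real n - 2)" using n by simp
    ultimately show ?thesis unfolding real_choose_three power2_eq_square by linarith
  qed
  ultimately show False using upper by linarith
qed

lemma M_tight_edges_ge:
  assumes "14 \<le> n"
  shows "6 / 25 * real (n choose 3) \<le> real (M n 2 3 2 3)"
proof -
  have "nat \<lceil>6 / 25 * real (n choose 3)\<rceil> \<le> M n 2 3 2 3"
  proof (rule M_geI)
    fix c assume "c \<in> colorings 2 (complete_hypergraph n 3)"
    then obtain i C where i: "i \<in> {1..2}" and C: "C \<in> tight_components 2 (color_class n 3 c i)"
      and le: "6 / 25 * real (n choose 3) \<le> real (card C)"
      using tight_component_ge[OF assms] by blast
    have "shadow 3 C = C" using tight_component_color_class_subset[OF C] by (rule shadow_self)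
    then have "nat \<lceil>6 / 25 * real (n choose 3)\<rceil> \<le> card (shadow 3 C)"
      using le by (simp add: nat_le_iff ceiling_le_iff)
    then show "\<exists>i\<in>{1..2}. \<exists>C\<in>tight_components 2 (color_class n 3 c i).
        nat \<lceil>6 / 25 * real (n choose 3)\<rceil> \<le> card (shadow 3 C)"
      using i C by blast
  qed (use assms in auto)
  then show ?thesis by (simp add: nat_le_iff ceiling_le_iff)
qed

lemma M_tight_edges_limit_ge:
  assumes "(\<lambda>n. real (M n 2 3 2 3) / real (n choose 3)) \<longlonglongrightarrow> L"
  shows "6 / 25 \<le> L"
proof (rule LIMSEQ_le_const[OF assms])
  have "6 / 25 \<le> real (M n 2 3 2 3) / real (n choose 3)" if n: "14 \<le> n" for n
    using M_tight_edges_ge[OF n] n by (simp add: pos_le_divide_eq)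
  then show "\<exists>N. \<forall>n\<ge>N. 6 / 25 \<le> real (M n 2 3 2 3) / real (n choose 3)" by blast
qed

section \<open>The minimax quantity for two-coloured triples\<close>

theorem corollary1p5:
  shows "(\<forall>n\<ge>3.
            M n 2 3 1 1 = n \<and>
            M n 2 3 1 2 = (n choose 2) - ((n div 2) choose 2) \<and>
            M n 2 3 2 1 = n \<and>
            M n 2 3 2 2 = (n choose 2) - ((n div 2) choose 2))
       \<and> (\<lambda>n. real (M n 2 3 1 3) / real (n choose 3)) \<longlonglongrightarrow> 6 * sqrt 21 - 27
       \<and> \<bar>(6 * sqrt 21 - 27) - 0.495\<bar> < (0.0005::real)
       \<and> (\<exists>L::real. (\<lambda>n. real (M n 2 3 2 3) / real (n choose 3)) \<longlonglongrightarrow> L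
            \<and> 0.24 \<le> L \<and> L \<le> 3 / 8)"
proof (intro conjI allI impI)
  fix n :: nat assume n: "3 \<le> n"
  have mono: "M n 2 3 2 s \<le> M n 2 3 1 s" for s
    using n by (intro M_antimono_tightness) auto
  show "M n 2 3 1 1 = n" "M n 2 3 2 1 = n"
    using M_vertices_le[OF n] M_vertices_ge[OF n] mono[of 1] le_antisym order_trans by metis+
  show "M n 2 3 1 2 = (n choose 2) - ((n div 2) choose 2)"
    "M n 2 3 2 2 = (n choose 2) - ((n div 2) choose 2)"
    using M_pairs_le[OF n] M_pairs_ge[OF n] mono[of 2] le_antisym order_trans by metis+
next
  show "(\<lambda>n. real (M n 2 3 1 3) / real (n choose 3)) \<longlonglongrightarrow> 6 * sqrt 21 - 27"
    by (rule M_connected_edges_tendsto)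
next
  have "sqrt ((45825 / 10000)\<^sup>2) < sqrt 21" "sqrt 21 < sqrt ((458258 / 100000)\<^sup>2)"
    by (intro real_sqrt_less_mono; simp add: power2_eq_square)+
  then have "45825 / 10000 < sqrt 21" "sqrt 21 < 458258 / 100000" by simp_all
  then show "\<bar>(6 * sqrt 21 - 27) - 0.495\<bar> < (0.0005::real)" by (simp add: abs_less_iff)
next
  obtain L where L: "(\<lambda>n. real (M n 2 3 2 3) / real (n choose 3)) \<longlonglongrightarrow> L"
    using M_tight_edges_convergent by blast
  then show "\<exists>L::real. (\<lambda>n. real (M n 2 3 2 3) / real (n choose 3)) \<longlonglongrightarrow> L \<and> 0.24 \<le> L \<and> L \<le> 3 / 8"
    using M_tight_edges_limit_ge[OF L] M_tight_edges_limit_le[OF L] by (intro exI[of _ L]) simp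
qed

end
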